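(* Consider the multi-agent MILP $(\mathcal{P})$, with optimal cost $J^\star_{\mathcal{P}}$, and the infinite sequences $\{x_i(k)\}_{k\ge 1}$ ($i=1,\dots,m$), $\{\lambda(k)\}_{k\ge 0}$, $\{\rho(k)\}_{k\ge 1}$ generated by Algorithm 1, both described in the context. Assume that: (Boundedness) the sets $X_i$, $i=1,\dots,m$, are bounded; (Uniqueness) the problems $\overline{\mathcal{P}}_{\mathrm{LP}}$ and $\overline{\mathcal{D}}$ defined in the context (which involve the limiting value $\bar\rho$ of $\{\rho(k)\}_{k\ge1}$) have unique solutions $\bar{x}^\star_{\mathrm{LP}}$ and $\bar\lambda^\star$, respectively; (Slater) there exist a scalar $\zeta>0$ and $\hat x_i\in\mathrm{conv}(X_i)$, $i=1,\dots,m$, such that $\sum_{i=1}^m A_i\hat x_i\le b-\bar\rho-m\zeta\mathbb{1}$, where $\mathbb{1}\in\mathbb{R}^p$ is the vector with all entries equal to one. Then there exists a finite iteration index $K$ such that, for all $k\ge K$, $x(k)=[x_1(k)^\top\;\cdots\;x_m(k)^\top]^\top$ is a feasible solution for $(\mathcal{P})$ that satisfies $$\sum_{i=1}^m c_i^\top x_i(k)-J^\star_{\mathcal{P}}\le\bar\gamma+\frac{\|\bar\rho\|_\infty}{p\,\zeta}\,\tilde\gamma,$$ where $\bar\gamma$ and $\tilde\gamma$ are defined in the context.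
   Context: All vector inequalities, and $\max$/$\min$ of vectors in $\mathbb{R}^p$, are component-wise; $[\,\cdot\,]_+$ denotes projection onto the non-negative orthant $\mathbb{R}^p_+$. Problem $(\mathcal{P})$: given $m$ agents, minimize $\sum_{i=1}^m c_i^\top x_i$ over $x_1,\dots,x_m$ subject to $\sum_{i=1}^m A_i x_i\le b$ and $x_i\in X_i$, $i=1,\dots,m$, where $c_i\in\mathbb{R}^{n_i}$, $A_i\in\mathbb{R}^{p\times n_i}$, $b\in\mathbb{R}^p$, and $X_i=\{x_i\in\mathbb{R}^{n_{c,i}}\times\mathbb{Z}^{n_{d,i}}: D_i x_i\le d_i\}$ is non-empty, with $n_{c,i}+n_{d,i}=n_i$ and $D_i,d_i$ a matrix and a vector of appropriate dimensions. $\mathrm{conv}(X_i)$ is the convex hull of $X_i$, and $\mathrm{vert}(X_i)$ denotes the set of vertices (extreme points) of $\mathrm{conv}(X_i)$; when $X_i$ is bounded this is a finite non-empty subset of $X_i$. Algorithm 1: the step sizes $\alpha(k)>0$ satisfy $\lim_{k\to\infty}\alpha(k)=0$ and $\sum_{k=0}^\infty\alpha(k)=\infty$. Initialize $\lambda(0)=0\in\mathbb{R}^p$ and, for $i=1,\dots,m$, $\bar s_i(0)=-\infty$, $\underline{s}_i(0)=+\infty$ (all components). For $k=0,1,2,\dots$: 1. for each $i$, $x_i(k+1)\in\arg\min_{x_i\in\mathrm{vert}(X_i)}(c_i^\top+\lambda(k)^\top A_i)x_i$, ties being broken by a deterministic rule; 2. for each $i$, $\bar s_i(k+1)=\max\{\bar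 s_i(k),A_ix_i(k+1)\}$, $\underline{s}_i(k+1)=\min\{\underline{s}_i(k),A_ix_i(k+1)\}$, $\rho_i(k+1)=\bar s_i(k+1)-\underline{s}_i(k+1)$; 3. $\rho(k+1)=p\max\{\rho_1(k+1),\dots,\rho_m(k+1)\}$; 4. $\lambda(k+1)=\big[\lambda(k)+\alpha(k)\big(\sum_{i=1}^m A_ix_i(k+1)-b+\rho(k+1)\big)\big]_+$. The algorithm is run without stopping, so infinite sequences are generated. When the $X_i$ are bounded, $\{\rho(k)\}_{k\ge1}$ is component-wise non-decreasing and takes values in a finite set, hence it is eventually constant; $\bar\rho\in\mathbb{R}^p$ denotes its limiting value. Similarly, for $k\ge1$ let $$\gamma(k)=p\max_{i\in\{1,\dots,m\}}\Big\{\max_{1\le r\le k}c_i^\top x_i(r)-\min_{1\le r\le k}c_i^\top x_i(r)\Big\};$$ this sequence is non-decreasing and takes values in a finite set, hence it is eventually constant, and $\bar\gamma$ denotes its limiting value. Finally, $$\tilde\gamma=p\max_{i\in\{1,\dots,m\}}\Big\{\max_{x_i\in X_i}c_i^\top x_i-\min_{x_i\in X_i}c_i^\top x_i\Big\}.$$ $\overline{\mathcal{P}}_{\mathrm{LP}}$ is the linear program: minimize $\sum_{i=1}^m c_i^\top x_i$ subject to $\sum_{i=1}^m A_ix_i\le b-\bar\rho$ and $x_i\in\mathrm{conv}(X_i)$, $i=1,\dots,m$. $\overline{\mathcal{D}}$ is its dual: $\max_{\lambda\ge0}\ -\lambda^\top(b-\bar\rho)+\sum_{i=1}^m\min_{x_i\in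 X_i}(c_i^\top+\lambda^\top A_i)x_i$. *)

theory Defs
  imports "HOL-Analysis.Analysis"
begin

text \<open>
  The agents are the elements of the finite type \<open>'m\<close> and \<open>\<real>\<^sup>p\<close> is \<open>real ^ 'p\<close>. Since the dimensions
  \<open>n\<^sub>i\<close> differ from agent to agent, \<open>\<real>\<close>-\<open>n\<^sub>i\<close> is the coordinate subspace of a common space \<open>real ^ 'n\<close>
  spanned by the coordinates in \<open>C\<^sub>i \<union> Z\<^sub>i\<close>. Here \<open>C\<^sub>i\<close> (continuous) and \<open>Z\<^sub>i\<close> (integer) are disjoint, and
  \<open>card C\<^sub>i\<close>, \<open>card Z\<^sub>i\<close> are the numbers of continuous and of discrete variables of agent \<open>i\<close>. All points
  of an agent vanish outside its block, so the entries of \<open>c\<^sub>i\<close>, \<open>A\<^sub>i\<close>, \<open>D\<^sub>i\<close> belonging to other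
  coordinates are immaterial.
\<close>

text \<open>The system \<open>D x \<le> d\<close> has \<open>q\<close> rows, given by \<open>D r\<close> and \<open>d r\<close> for \<open>r < q\<close>.\<close>

definition mixed_integer_set ::
    "'n::finite set \<Rightarrow> 'n set \<Rightarrow> nat \<Rightarrow> (nat \<Rightarrow> real ^ 'n) \<Rightarrow> (nat \<Rightarrow> real) \<Rightarrow> (real ^ 'n) set" where
  "mixed_integer_set C Z q D d =
     {x. (\<forall>j. j \<notin> C \<union> Z \<longrightarrow> x $ j = 0) \<and> (\<forall>j\<in>Z. x $ j \<in> \<int>) \<and> (\<forall>r<q. D r \<bullet> x \<le> d r)}"

definition total_cost :: "('m::finite \<Rightarrow> real ^ 'n) \<Rightarrow> ('m \<Rightarrow> real ^ 'n) \<Rightarrow> real" where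
  "total_cost c x = (\<Sum>i\<in>UNIV. c i \<bullet> x i)"

definition coupled_feasible ::
    "('m::finite \<Rightarrow> real ^ 'n ^ 'p) \<Rightarrow> real ^ 'p \<Rightarrow> ('m \<Rightarrow> (real ^ 'n) set) \<Rightarrow> ('m \<Rightarrow> real ^ 'n) \<Rightarrow> bool" where
  "coupled_feasible A b S x \<longleftrightarrow> (\<Sum>i\<in>UNIV. A i *v x i) \<le> b \<and> (\<forall>i. x i \<in> S i)"

text \<open>The infimum is over a nonempty set that is bounded below whenever the problem is feasible and all
  \<open>X i\<close> are bounded.\<close>

definition optimal_cost ::
    "('m::finite \<Rightarrow> real ^ 'n) \<Rightarrow> ('m \<Rightarrow> real ^ 'n ^ 'p) \<Rightarrow> real ^ 'p \<Rightarrow> ('m \<Rightarrow> (real ^ 'n) set) \<Rightarrow> real" where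
  "optimal_cost c A b X = (INF x\<in>{x. coupled_feasible A b X x}. total_cost c x)"

definition lp_solution ::
    "('m::finite \<Rightarrow> real ^ 'n) \<Rightarrow> ('m \<Rightarrow> real ^ 'n ^ 'p) \<Rightarrow> real ^ 'p \<Rightarrow> ('m \<Rightarrow> (real ^ 'n) set)
      \<Rightarrow> ('m \<Rightarrow> real ^ 'n) \<Rightarrow> bool" where
  "lp_solution c A b X = is_arg_min (total_cost c) (coupled_feasible A b (\<lambda>i. convex hull X i))"

definition dual_objective ::
    "('m::finite \<Rightarrow> real ^ 'n) \<Rightarrow> ('m \<Rightarrow> real ^ 'n ^ 'p) \<Rightarrow> real ^ 'p \<Rightarrow> ('m \<Rightarrow> (real ^ 'n) set)
      \<Rightarrow> real ^ 'p \<Rightarrow> real" where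
  "dual_objective c A b X l = - (l \<bullet> b) + (\<Sum>i\<in>UNIV. INF x\<in>X i. (c i + l v* A i) \<bullet> x)"

definition dual_solution ::
    "('m::finite \<Rightarrow> real ^ 'n) \<Rightarrow> ('m \<Rightarrow> real ^ 'n ^ 'p) \<Rightarrow> real ^ 'p \<Rightarrow> ('m \<Rightarrow> (real ^ 'n) set)
      \<Rightarrow> real ^ 'p \<Rightarrow> bool" where
  "dual_solution c A b X = is_arg_max (dual_objective c A b X) (\<lambda>l. 0 \<le> l)"

text \<open>The iterates \<open>x\<close> are used from index 1 on; \<open>x 0\<close> is never read.\<close>

primrec s_upper ::
    "('m \<Rightarrow> real ^ 'n ^ 'p) \<Rightarrow> (nat \<Rightarrow> 'm \<Rightarrow> real ^ 'n) \<Rightarrow> nat \<Rightarrow> 'm \<Rightarrow> ereal ^ 'p" where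
  "s_upper A x 0 = (\<lambda>i. \<chi> j. - \<infinity>)"
| "s_upper A x (Suc k) = (\<lambda>i. \<chi> j. max (s_upper A x k i $ j) (ereal ((A i *v x (Suc k) i) $ j)))"

primrec s_lower ::
    "('m \<Rightarrow> real ^ 'n ^ 'p) \<Rightarrow> (nat \<Rightarrow> 'm \<Rightarrow> real ^ 'n) \<Rightarrow> nat \<Rightarrow> 'm \<Rightarrow> ereal ^ 'p" where
  "s_lower A x 0 = (\<lambda>i. \<chi> j. \<infinity>)"
| "s_lower A x (Suc k) = (\<lambda>i. \<chi> j. min (s_lower A x k i $ j) (ereal ((A i *v x (Suc k) i) $ j)))"

text \<open>For \<open>k \<ge> 1\<close> all entries of \<open>s_upper\<close> and \<open>s_lower\<close> are finite, so \<open>real_of_ereal\<close> is exact there.\<close>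

definition rho_agent ::
    "('m \<Rightarrow> real ^ 'n ^ 'p) \<Rightarrow> (nat \<Rightarrow> 'm \<Rightarrow> real ^ 'n) \<Rightarrow> nat \<Rightarrow> 'm \<Rightarrow> real ^ 'p" where
  "rho_agent A x k i = (\<chi> j. real_of_ereal (s_upper A x k i $ j - s_lower A x k i $ j))"

definition rho_seq ::
    "('m::finite \<Rightarrow> real ^ 'n ^ 'p) \<Rightarrow> (nat \<Rightarrow> 'm \<Rightarrow> real ^ 'n) \<Rightarrow> nat \<Rightarrow> real ^ 'p" where
  "rho_seq A x k = (\<chi> j. real CARD('p) * (MAX i. rho_agent A x k i $ j))"

text \<open>The parameter \<open>tie\<close> is the deterministic tie-breaking rule: the minimizer picked by an agent is a
  function of the current multiplier.\<close>

definition algorithm_run ::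
    "('m::finite \<Rightarrow> real ^ 'n) \<Rightarrow> ('m \<Rightarrow> real ^ 'n ^ 'p) \<Rightarrow> real ^ 'p \<Rightarrow> ('m \<Rightarrow> (real ^ 'n) set)
      \<Rightarrow> (nat \<Rightarrow> real) \<Rightarrow> ('m \<Rightarrow> real ^ 'p \<Rightarrow> real ^ 'n)
      \<Rightarrow> (nat \<Rightarrow> 'm \<Rightarrow> real ^ 'n) \<Rightarrow> (nat \<Rightarrow> real ^ 'p) \<Rightarrow> bool" where
  "algorithm_run c A b X \<alpha> tie x lam \<longleftrightarrow>
     lam 0 = 0 \<and>
     (\<forall>k i. is_arg_min (\<lambda>v. (c i + lam k v* A i) \<bullet> v) (\<lambda>v. v extreme_point_of (convex hull X i))
                      (x (Suc k) i)
            \<and> x (Suc k) i = tie i (lam k)) \<and>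
     (\<forall>k. lam (Suc k) =
            closest_point {v. 0 \<le> v}
              (lam k + \<alpha> k *\<^sub>R ((\<Sum>i\<in>UNIV. A i *v x (Suc k) i) - b + rho_seq A x (Suc k))))"

text \<open>The dimension \<open>p\<close> does not occur in the types of the data of the next two quantities, so it is an
  argument.\<close>

definition gamma_seq ::
    "nat \<Rightarrow> ('m::finite \<Rightarrow> real ^ 'n) \<Rightarrow> (nat \<Rightarrow> 'm \<Rightarrow> real ^ 'n) \<Rightarrow> nat \<Rightarrow> real" where
  "gamma_seq p c x k =
     real p * (MAX i. (MAX r\<in>{1..k}. c i \<bullet> x r i) - (MIN r\<in>{1..k}. c i \<bullet> x r i))"

definition gamma_tilde ::
    "nat \<Rightarrow> ('m::finite \<Rightarrow> real ^ 'n) \<Rightarrow> ('m \<Rightarrow> (real ^ 'n) set) \<Rightarrow> real" where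
  "gamma_tilde p c X = real p * (MAX i. (SUP x\<in>X i. c i \<bullet> x) - (INF x\<in>X i. c i \<bullet> x))"

end

theory Submission
  imports Defs
begin

text \<open>
  The tightening settles at \<open>rhobar\<close> after finitely many steps, and from then on the algorithm is a
  projected subgradient method for the dual of the tightened linear program, so the multipliers converge
  to its unique solution. Hence eventually every agent picks a vertex of its optimal face. Uniqueness of
  the dual solution makes the primal solution relatively interior to the product of the optimal faces, and
  uniqueness of the primal solution then leaves at most \<open>p\<close> faces with more than one point. All other
  agents agree with the primal solution. The remaining ones deviate from it, in load and in cost, by at
  most the spread over the visited points, because the primal solution lies in the convex hull of these.
  The tightening compensates \<open>p\<close> such deviations. The price of the tightening is at most the pairing of
  the multiplier with \<open>rhobar\<close>, and the Slater point bounds the multiplier.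
\<close>

section \<open>The vertices of a mixed-integer set\<close>

lemma closed_mixed_integer_set:
  fixes C Z :: "'n::finite set"
  shows "closed (mixed_integer_set C Z q D d)"
proof -
  have "mixed_integer_set C Z q D d =
      (\<Inter>j\<in>- (C \<union> Z). {x. x $ j = 0}) \<inter> (\<Inter>j\<in>Z. (\<lambda>x. x $ j) -` \<int>) \<inter> (\<Inter>r\<in>{..<q}. {x. D r \<bullet> x \<le> d r})"
    unfolding mixed_integer_set_def by auto
  moreover have "closed ((\<lambda>x::real ^ 'n. x $ j) -` \<int>)" for j :: 'n
    by (rule continuous_closed_vimage) (auto simp: closed_Ints)
  moreover have "closed {x::real ^ 'n. x $ j = 0}" for j :: 'n
    by (intro closed_Collect_eq continuous_intros)
  ultimately show ?thesis
    by (simp only:) (intro closed_Int closed_INT ballI closed_halfspace_le)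
qed

text \<open>Fixing the integer coordinates cuts the set into finitely many polytopes, and a vertex of the
  convex hull is a vertex of the slice that contains it.\<close>

lemma finite_extreme_points_mixed_integer:
  fixes C Z :: "'n::finite set"
  assumes "bounded (mixed_integer_set C Z q D d)"
  shows "finite {v. v extreme_point_of (convex hull (mixed_integer_set C Z q D d))}"
proof -
  define S where "S = mixed_integer_set C Z q D d"
  obtain M where M: "\<And>x. x \<in> S \<Longrightarrow> norm x \<le> M"
    using assms bounded_iff unfolding S_def by blast
  \<comment> \<open>Boundedness restricts the integer coordinates to the finitely many patterns in
    \<open>F\<close>; \<open>PiE\<close> fixes the values off \<open>Z\<close>, which keeps
    \<open>F\<close> finite.\<close>
  define B where "B = nat \<lceil>M\<rceil>"
  define F where "F = (PiE Z (\<lambda>_. {- int B..int B}))"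
  define P where "P f = {x. \<forall>j. j \<notin> C \<union> Z \<longrightarrow> x $ j = 0} \<inter> {x. \<forall>j\<in>Z. x $ j = of_int (f j)} \<inter>
      {x. \<forall>r<q. D r \<bullet> x \<le> d r}" for f :: "'n \<Rightarrow> int"
  have finF: "finite F"
    unfolding F_def by (intro finite_PiE) auto
  have PS: "P f \<subseteq> S" for f
    unfolding P_def S_def mixed_integer_set_def by auto
  have poly: "polyhedron (P f)" for f
  proof -
    have eq: "P f = \<Inter> ((\<lambda>j. {x. axis j 1 \<bullet> x = 0}) ` (- (C \<union> Z))) \<inter>
        \<Inter> ((\<lambda>j. {x. axis j 1 \<bullet> x = of_int (f j)}) ` Z) \<inter> \<Inter> ((\<lambda>r. {x. D r \<bullet> x \<le> d r}) ` {..<q})"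
      unfolding P_def by (auto simp: inner_axis inner_commute)
    show ?thesis
      unfolding eq
      by (intro polyhedron_Int polyhedron_Inter)
        (auto simp: polyhedron_hyperplane polyhedron_halfspace_le)
  qed
  have cover: "\<exists>f\<in>F. x \<in> P f" if "x \<in> S" for x
  proof -
    define f where "f = restrict (\<lambda>j. \<lfloor>x $ j\<rfloor>) Z"
    have "real_of_int \<lfloor>x $ j\<rfloor> = x $ j" if "j \<in> Z" for j
      using \<open>x \<in> S\<close> that unfolding S_def mixed_integer_set_def by auto
    moreover have "\<lfloor>x $ j\<rfloor> \<in> {- int B..int B}" if "j \<in> Z" for j
    proof -
      have "\<bar>x $ j\<bar> \<le> M"
        using M[OF \<open>x \<in> S\<close>] component_le_norm_cart[of x j] by linarith
      then have "\<bar>real_of_int \<lfloor>x $ j\<rfloor>\<bar> \<le> real B"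
        unfolding B_def calculation[OF that] by linarith
      then show ?thesis
        by auto
    qed
    ultimately have "f \<in> F" "x \<in> P f"
      using \<open>x \<in> S\<close> unfolding F_def f_def P_def S_def mixed_integer_set_def by auto
    then show ?thesis
      by blast
  qed
  have "{v. v extreme_point_of (convex hull S)} \<subseteq> (\<Union>f\<in>F. {v. v extreme_point_of P f})"
  proof safe
    fix v assume v: "v extreme_point_of (convex hull S)"
    then have "v \<in> S"
      by (rule extreme_point_of_convex_hull)
    then obtain f where f: "f \<in> F" "v \<in> P f"
      using cover by blast
    have "P f \<subseteq> convex hull S"
      using PS hull_subset[of S convex] by blast
    then have "v extreme_point_of P f"
      using v f(2) unfolding extreme_point_of_def by blast
    then show "v \<in> (\<Union>f\<in>F. {v. v extreme_point_of P f})"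
      using f(1) by blast
  qed
  moreover have "finite (\<Union>f\<in>F. {v. v extreme_point_of P f})"
    using finF finite_polyhedron_extreme_points[OF poly] by blast
  ultimately show ?thesis
    unfolding S_def by (rule finite_subset)
qed

section \<open>Convergence of the subgradient iteration\<close>

text \<open>Truncation at zero is the best non-negative choice in every coordinate separately, hence
  also for the norm.\<close>

lemma closest_point_nonneg_orthant:
  fixes u :: "real ^ 'p"
  shows "closest_point {v. 0 \<le> v} u = (\<chi> j. max 0 (u $ j))"
proof (rule closest_point_unique[symmetric])
  show "convex {v :: real ^ 'p. 0 \<le> v}"
    by (auto simp: convex_def less_eq_vec_def)
  have "{v :: real ^ 'p. 0 \<le> v} = (\<Inter>j. {v. 0 \<le> v $ j})"
    by (auto simp: less_eq_vec_def)
  then show "closed {v :: real ^ 'p. 0 \<le> v}"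
    by (simp only:) (intro closed_INT ballI closed_Collect_le continuous_intros)
  show "\<forall>z\<in>{v. 0 \<le> v}. dist u (\<chi> j. max 0 (u $ j)) \<le> dist u z"
  proof
    fix z :: "real ^ 'p" assume "z \<in> {v. 0 \<le> v}"
    then have "\<bar>(u - (\<chi> j. max 0 (u $ j))) $ j\<bar> \<le> \<bar>(u - z) $ j\<bar>" for j
      by (simp add: less_eq_vec_def max_def) (smt (verit))
    then show "dist u (\<chi> j. max 0 (u $ j)) \<le> dist u z"
      unfolding dist_norm by (intro norm_le_componentwise_cart) auto
  qed
qed (auto simp: less_eq_vec_def)

text \<open>No coordinate moves away from a non-negative target under truncation, so projecting
  never undoes progress towards a dual solution.\<close>

lemma dist_pos_part_le:
  fixes u w :: "real ^ 'p"
  assumes "0 \<le> w"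
  shows "norm ((\<chi> j. max 0 (u $ j)) - w) \<le> norm (u - w)"
  using assms by (intro norm_le_componentwise_cart) (simp add: less_eq_vec_def max_def, smt (verit))

text \<open>While \<open>D\<close> is away from 0, the linear gain beats the quadratic error, and
  divergence of the step sums forces \<open>D\<close> to become small. Later steps are too short to
  carry it far away again.\<close>

lemma diminishing_step_tendsto_zero:
  fixes D h \<alpha> :: "nat \<Rightarrow> real"
  assumes nonneg: "\<And>k. 0 \<le> D k"
    and step_pos: "\<And>k. \<alpha> k > 0"
    and step_lim: "\<alpha> \<longlonglongrightarrow> 0"
    and step_sum: "filterlim (\<lambda>N. \<Sum>k<N. \<alpha> k) at_top sequentially"
    and descent: "eventually (\<lambda>k. D (Suc k) \<le> D k - 2 * \<alpha> k * h k + (\<alpha> k)\<^sup>2 * G) sequentially"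
    and h_nonneg: "\<And>k. 0 \<le> h k"
    and gap: "\<And>\<delta>. \<delta> > 0 \<Longrightarrow> \<exists>\<eta>>0. \<forall>k. \<delta> \<le> D k \<longrightarrow> \<eta> \<le> h k"
  shows "D \<longlonglongrightarrow> 0"
proof (rule order_tendstoI)
  fix e :: real assume "e < 0"
  then show "eventually (\<lambda>k. e < D k) sequentially"
    by (intro always_eventually allI) (rule order.strict_trans2[OF _ nonneg])
next
  fix e :: real assume "0 < e"
  \<comment> \<open>Above \<open>\<epsilon> / 2\<close> a step decreases \<open>D\<close>; below it
    a step adds less than \<open>\<epsilon> / 2\<close>. So \<open>D\<close> never leaves the range
    up to \<open>\<epsilon>\<close>, which is strictly below \<open>e\<close>.\<close>
  define \<epsilon> where "\<epsilon> = e / 2"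
  have \<epsilon>: "\<epsilon> > 0" "\<epsilon> < e"
    using \<open>0 < e\<close> unfolding \<epsilon>_def by auto
  obtain \<eta> where \<eta>: "\<eta> > 0" "\<And>k. \<epsilon> / 2 \<le> D k \<Longrightarrow> \<eta> \<le> h k"
    using gap[of "\<epsilon> / 2"] \<epsilon> by auto
  have "(\<lambda>k. \<alpha> k * G) \<longlonglongrightarrow> 0 * G" "(\<lambda>k. (\<alpha> k)\<^sup>2 * G) \<longlonglongrightarrow> 0\<^sup>2 * G"
    by (intro tendsto_intros step_lim)+
  then have "eventually (\<lambda>k. \<alpha> k * G < \<eta>) sequentially"
    "eventually (\<lambda>k. (\<alpha> k)\<^sup>2 * G < \<epsilon> / 2) sequentially"
    using \<eta>(1) \<epsilon>(1) order_tendstoD(2)[of _ 0 sequentially \<eta>] order_tendstoD(2)[of _ 0 sequentially "\<epsilon> / 2"]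
    by simp_all
  with descent have "eventually (\<lambda>k. \<alpha> k * G < \<eta> \<and> (\<alpha> k)\<^sup>2 * G < \<epsilon> / 2 \<and>
      D (Suc k) \<le> D k - 2 * \<alpha> k * h k + (\<alpha> k)\<^sup>2 * G) sequentially"
    by (auto intro: eventually_conj)
  then obtain N where N: "\<And>k. k \<ge> N \<Longrightarrow> \<alpha> k * G < \<eta>"
    "\<And>k. k \<ge> N \<Longrightarrow> (\<alpha> k)\<^sup>2 * G < \<epsilon> / 2"
    "\<And>k. k \<ge> N \<Longrightarrow> D (Suc k) \<le> D k - 2 * \<alpha> k * h k + (\<alpha> k)\<^sup>2 * G"
    unfolding eventually_sequentially by blast
  \<comment> \<open>One of the two copies of \<open>\<alpha> k * h k\<close> absorbs the error term,
    the other gives the decrease.\<close>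
  have far: "D (Suc k) \<le> D k - \<eta> * \<alpha> k" if "k \<ge> N" "\<epsilon> / 2 \<le> D k" for k
  proof -
    have "\<alpha> k * (\<alpha> k * G) \<le> \<alpha> k * \<eta>" "\<alpha> k * \<eta> \<le> \<alpha> k * h k"
      using N(1)[OF that(1)] \<eta>(2)[OF that(2)] step_pos[of k] by (auto intro: mult_left_mono)
    then show ?thesis
      using N(3)[OF that(1)] by (simp add: power2_eq_square algebra_simps)
  qed
  have stay: "D (Suc k) \<le> \<epsilon>" if "k \<ge> N" "D k \<le> \<epsilon>" for k
  proof (cases "\<epsilon> / 2 \<le> D k")
    case True
    then have "D (Suc k) \<le> D k - \<eta> * \<alpha> k"
      using far that by simp
    moreover have "0 < \<eta> * \<alpha> k"
      using \<eta>(1) step_pos by simp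
    ultimately show ?thesis
      using that by linarith
  next
    case False
    have "0 \<le> 2 * \<alpha> k * h k"
      using step_pos[of k] h_nonneg[of k] by simp
    then show ?thesis
      using N(2,3)[OF that(1)] False by linarith
  qed
  have "\<exists>k\<ge>N. D k < \<epsilon> / 2"
  proof (rule ccontr)
    assume "\<not> ?thesis"
    \<comment> \<open>The decreases add up to \<open>\<eta>\<close> times an unbounded step sum,
      while \<open>D\<close> is non-negative.\<close>
    then have "D (N + n) \<le> D N - \<eta> * ((\<Sum>k<N + n. \<alpha> k) - (\<Sum>k<N. \<alpha> k))" for n
    proof (induction n)
      case (Suc n)
      then have "D (Suc (N + n)) \<le> D (N + n) - \<eta> * \<alpha> (N + n)"
        by (intro far) (auto simp: not_less)
      then show ?case
        using Suc by (simp add: algebra_simps)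
    qed simp
    then have le: "\<eta> * (\<Sum>k<N + n. \<alpha> k) \<le> D N + \<eta> * (\<Sum>k<N. \<alpha> k)" for n
      using nonneg[of "N + n"] by (smt (verit) right_diff_distrib)
    obtain n where n: "\<And>m. m \<ge> n \<Longrightarrow> (\<Sum>k<m. \<alpha> k) > (D N + \<eta> * (\<Sum>k<N. \<alpha> k)) / \<eta>"
      using step_sum unfolding filterlim_at_top_dense eventually_sequentially by blast
    then have "(D N + \<eta> * (\<Sum>k<N. \<alpha> k)) / \<eta> < (\<Sum>k<N + n. \<alpha> k)"
      by simp
    then show False
      using le[of n] \<eta>(1) by (simp add: field_simps)
  qed
  then obtain K where K: "K \<ge> N" "D K \<le> \<epsilon>"
    using \<epsilon>(1) by force
  have "D k \<le> \<epsilon>" if "k \<ge> K" for k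
    using that by (induction k rule: dec_induct) (use K stay in auto)
  then show "eventually (\<lambda>k. D k < e) sequentially"
    using \<epsilon>(2) unfolding eventually_sequentially by (meson order.strict_trans1)
qed

text \<open>Otherwise some hyperplane through 0 has the relative interior on one side, and by
  closure all of \<open>M\<close>.\<close>

lemma zero_in_rel_interior:
  fixes M :: "'a::euclidean_space set"
  assumes "convex M" "\<And>a. a \<noteq> 0 \<Longrightarrow> \<exists>x\<in>M. a \<bullet> x < 0"
  shows "0 \<in> rel_interior M"
proof (rule ccontr)
  assume "0 \<notin> rel_interior M"
  then obtain a where a: "a \<noteq> 0" "\<forall>x\<in>rel_interior M. 0 \<le> a \<bullet> x"
    using separating_hyperplane_set_0 convex_rel_interior[OF assms(1)] by blast
  have "closure (rel_interior M) \<subseteq> {x. 0 \<le> a \<bullet> x}"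
    using a(2) by (intro closure_minimal) (auto simp: closed_halfspace_ge)
  moreover have "M \<subseteq> closure (rel_interior M)"
    using convex_closure_rel_interior[OF assms(1)] closure_subset by auto
  ultimately show False
    using assms(2)[OF a(1)] by fastforce
qed

section \<open>Lagrangian duality for the coupled linear program\<close>

definition load :: "('m::finite \<Rightarrow> real ^ 'n ^ 'p) \<Rightarrow> ('m \<Rightarrow> real ^ 'n) \<Rightarrow> real ^ 'p" where
  "load A z = (\<Sum>i\<in>UNIV. A i *v z i)"

definition lagrangian ::
    "('m::finite \<Rightarrow> real ^ 'n) \<Rightarrow> ('m \<Rightarrow> real ^ 'n ^ 'p) \<Rightarrow> real ^ 'p \<Rightarrow> real ^ 'p
      \<Rightarrow> ('m \<Rightarrow> real ^ 'n) \<Rightarrow> real" where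
  "lagrangian c A b l z = total_cost c z + l \<bullet> (load A z - b)"

definition reduced_cost ::
    "('m::finite \<Rightarrow> real ^ 'n) \<Rightarrow> ('m \<Rightarrow> real ^ 'n ^ 'p) \<Rightarrow> real ^ 'p \<Rightarrow> 'm \<Rightarrow> real ^ 'n" where
  "reduced_cost c A l i = c i + l v* A i"

text \<open>For a fixed multiplier the Lagrangian separates over the agents, so it is minimised
  agent by agent.\<close>

lemma lagrangian_reduced_cost:
  "lagrangian c A b l z = - (l \<bullet> b) + (\<Sum>i\<in>UNIV. reduced_cost c A l i \<bullet> z i)"
  unfolding lagrangian_def load_def total_cost_def reduced_cost_def
  by (simp add: inner_diff_right inner_sum_right sum.distrib inner_add_left dot_lmul_matrix)

lemma load_convex_comb:
  "load A (\<lambda>i. u *\<^sub>R y i + v *\<^sub>R z i) = u *\<^sub>R load A y + v *\<^sub>R load A z"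
  unfolding load_def
  by (simp add: matrix_vector_right_distrib matrix_vector_mult_scaleR sum.distrib scaleR_sum_right)

lemma lagrangian_affine_multiplier:
  assumes "u + v = 1"
  shows "lagrangian c A b (u *\<^sub>R l + v *\<^sub>R l') z = u * lagrangian c A b l z + v * lagrangian c A b l' z"
proof -
  have "total_cost c z = u * total_cost c z + v * total_cost c z"
    using assms by (simp flip: distrib_right)
  then show ?thesis
    unfolding lagrangian_def by (simp add: inner_add_left algebra_simps)
qed

lemma tendsto_reduced_cost:
  fixes A :: "'m::finite \<Rightarrow> real ^ 'n::finite ^ 'p::finite"
  assumes "(f \<longlongrightarrow> l) F"
  shows "((\<lambda>s. reduced_cost c A (f s) i \<bullet> v) \<longlongrightarrow> reduced_cost c A l i \<bullet> v) F"
  unfolding reduced_cost_def inner_add_left dot_lmul_matrix by (intro tendsto_intros assms)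

text \<open>The load excess is the slope in the multiplier: it acts as subgradient in the iteration
  and as directional derivative at the dual solution.\<close>

lemma lagrangian_split:
  "lagrangian c A b l z = lagrangian c A b l' z + (l - l') \<bullet> (load A z - b)"
  unfolding lagrangian_def by (simp add: inner_diff_left)

lemma is_arg_maxI_le:
  assumes "P x" "\<And>y. P y \<Longrightarrow> f y \<le> (f x :: real)"
  shows "is_arg_max f P x"
  using assms unfolding is_arg_max_def by force

text \<open>Duality only sees compactness and the finitely many vertices of the mixed-integer sets.
  The parameter \<open>b\<close> later becomes the tightened \<open>b - rhobar\<close>.\<close>

locale coupled_lp =
  fixes c :: "'m::finite \<Rightarrow> real ^ 'n::finite"
    and A :: "'m \<Rightarrow> real ^ 'n ^ 'p::finite"
    and b :: "real ^ 'p"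
    and X :: "'m \<Rightarrow> (real ^ 'n) set"
  assumes compact_X: "\<And>i. compact (X i)"
    and X_nonempty: "\<And>i. X i \<noteq> {}"
    and finite_vertices: "\<And>i. finite {v. v extreme_point_of (convex hull X i)}"
begin

definition vertices :: "'m \<Rightarrow> (real ^ 'n) set" where
  "vertices i = {v. v extreme_point_of (convex hull X i)}"

text \<open>Taking minimizers over the hull, and not over \<open>X i\<close>, makes this set convex;
  it also contains fractional optima.\<close>

definition face :: "real ^ 'p \<Rightarrow> 'm \<Rightarrow> (real ^ 'n) set" where
  "face l i = {y \<in> convex hull X i. \<forall>w \<in> convex hull X i. reduced_cost c A l i \<bullet> y \<le> reduced_cost c A l i \<bullet> w}"

abbreviation "dual \<equiv> dual_objective c A b X"
abbreviation "lagr \<equiv> lagrangian c A b"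

section \<open>Agent subproblems and the dual function\<close>

lemma hull_eq_hull_vertices: "convex hull X i = convex hull (vertices i)"
  unfolding vertices_def
  by (intro Krein_Milman_Minkowski compact_convex_hull compact_X convex_convex_hull)

lemma vertices_subset: "vertices i \<subseteq> X i"
  unfolding vertices_def using extreme_point_of_convex_hull by blast

lemma vertices_nonempty: "vertices i \<noteq> {}"
  using hull_eq_hull_vertices[of i] X_nonempty[of i] by (metis convex_hull_eq_empty)

text \<open>A half-space containing all vertices contains their hull, so the vertex chosen by the
  algorithm is optimal over the whole hull.\<close>

lemma is_arg_min_vertex_face:
  assumes "is_arg_min (\<lambda>v. (c i + l v* A i) \<bullet> v) (\<lambda>v. v extreme_point_of (convex hull X i)) y"
  shows "y \<in> face l i" "y \<in> vertices i"
proof -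
  have y: "y \<in> vertices i" "\<And>v. v \<in> vertices i \<Longrightarrow> reduced_cost c A l i \<bullet> y \<le> reduced_cost c A l i \<bullet> v"
    using assms unfolding is_arg_min_def vertices_def reduced_cost_def by (auto simp: not_less)
  then have "convex hull (vertices i) \<subseteq> {w. reduced_cost c A l i \<bullet> y \<le> reduced_cost c A l i \<bullet> w}"
    by (intro hull_minimal) (auto simp: convex_halfspace_ge)
  then show "y \<in> face l i"
    using y(1) hull_inc[of y "vertices i" convex] unfolding face_def hull_eq_hull_vertices by blast
  show "y \<in> vertices i"
    by (fact y(1))
qed

lemma face_vertex:
  obtains y where "y \<in> face l i" "y \<in> vertices i"
proof -
  obtain y where "is_arg_min (\<lambda>v. (c i + l v* A i) \<bullet> v) (\<lambda>v. v \<in> vertices i) y"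
    using ex_is_arg_min_if_finite[of "vertices i"] finite_vertices vertices_nonempty
    unfolding vertices_def by metis
  then show ?thesis
    using is_arg_min_vertex_face[of i l y] that unfolding vertices_def by simp
qed

lemma face_subset_hull: "face l i \<subseteq> convex hull X i"
  unfolding face_def by blast

lemma convex_face: "convex (face l i)"
  unfolding convex_def
proof (intro ballI allI impI)
  fix y z :: "real ^ 'n" and u v :: real
  assume *: "y \<in> face l i" "z \<in> face l i" "0 \<le> u" "0 \<le> v" "u + v = 1"
  have "u *\<^sub>R y + v *\<^sub>R z \<in> convex hull X i"
    using * convexD[OF convex_convex_hull] face_subset_hull by blast
  moreover have "reduced_cost c A l i \<bullet> (u *\<^sub>R y + v *\<^sub>R z) \<le> reduced_cost c A l i \<bullet> w"
    if "w \<in> convex hull X i" for w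
  proof -
    have "u * (reduced_cost c A l i \<bullet> y) + v * (reduced_cost c A l i \<bullet> z) \<le>
        u * (reduced_cost c A l i \<bullet> w) + v * (reduced_cost c A l i \<bullet> w)"
      using * that unfolding face_def by (intro add_mono mult_left_mono) auto
    also have "\<dots> = reduced_cost c A l i \<bullet> w"
      using * by (simp flip: distrib_right)
    finally show ?thesis
      by (simp add: inner_add_right)
  qed
  ultimately show "u *\<^sub>R y + v *\<^sub>R z \<in> face l i"
    unfolding face_def by blast
qed

text \<open>Some minimizer over the hull is a vertex and hence lies in \<open>X i\<close>, so
  passing to the hull does not change the minimum.\<close>

lemma INF_eq_face:
  assumes "y \<in> face l i"
  shows "(INF x\<in>X i. (c i + l v* A i) \<bullet> x) = reduced_cost c A l i \<bullet> y"
proof (rule antisym)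
  obtain v where v: "v \<in> face l i" "v \<in> vertices i"
    by (rule face_vertex)
  have lower: "reduced_cost c A l i \<bullet> y \<le> (c i + l v* A i) \<bullet> x" if "x \<in> X i" for x
    using assms that hull_inc[of x "X i" convex] unfolding face_def reduced_cost_def by blast
  then show "reduced_cost c A l i \<bullet> y \<le> (INF x\<in>X i. (c i + l v* A i) \<bullet> x)"
    using X_nonempty by (intro cINF_greatest) auto
  have "(INF x\<in>X i. (c i + l v* A i) \<bullet> x) \<le> (c i + l v* A i) \<bullet> v"
    using v(2) vertices_subset lower by (intro cINF_lower) (auto intro!: bdd_belowI2)
  also have "\<dots> \<le> reduced_cost c A l i \<bullet> y"
    using v(1) assms unfolding face_def reduced_cost_def by blast
  finally show "(INF x\<in>X i. (c i + l v* A i) \<bullet> x) \<le> reduced_cost c A l i \<bullet> y" .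
qed

lemma dual_eq_lagrangian:
  assumes "\<And>i. z i \<in> face l i"
  shows "dual l = lagr l z"
  unfolding dual_objective_def lagrangian_reduced_cost using INF_eq_face[OF assms] by simp

lemma dual_le_lagrangian:
  assumes "\<And>i. z i \<in> convex hull X i"
  shows "dual l \<le> lagr l z"
proof -
  have "\<exists>y. y \<in> face l i" for i
    using face_vertex by blast
  then obtain y where y: "\<And>i. y i \<in> face l i"
    by metis
  then have "dual l = lagr l y"
    by (rule dual_eq_lagrangian)
  also have "\<dots> \<le> lagr l z"
    using y assms unfolding lagrangian_reduced_cost face_def by (auto intro!: sum_mono)
  finally show ?thesis .
qed

section \<open>Concavity of the dual function and stability of its minimizers\<close>

lemma obtain_face_vertices:
  obtains v where "\<And>i. v i \<in> face l i" "\<And>i. v i \<in> vertices i"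
proof -
  have "\<exists>y. y \<in> face l i \<and> y \<in> vertices i" for i
    using face_vertex by blast
  then show ?thesis
    using that by metis
qed

text \<open>A minimizer at the intermediate multiplier is a competitor at both ends, and its
  Lagrangian is affine in the multiplier.\<close>

lemma convex_neg_dual: "convex_on UNIV (\<lambda>l. - dual l)"
proof (rule convex_onI)
  fix t :: real and l l' :: "real ^ 'p"
  assume t: "0 < t" "t < 1"
  obtain v where v: "\<And>i. v i \<in> face ((1 - t) *\<^sub>R l + t *\<^sub>R l') i"
    using obtain_face_vertices by blast
  then have "v i \<in> convex hull X i" for i
    using face_subset_hull by blast
  then have "(1 - t) * dual l + t * dual l' \<le> (1 - t) * lagr l v + t * lagr l' v"
    using t by (intro add_mono mult_left_mono dual_le_lagrangian) auto
  also have "\<dots> = dual ((1 - t) *\<^sub>R l + t *\<^sub>R l')"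
    by (simp add: dual_eq_lagrangian[OF v] lagrangian_affine_multiplier)
  finally show "- dual ((1 - t) *\<^sub>R l + t *\<^sub>R l') \<le> (1 - t) * - dual l + t * - dual l'"
    by simp
qed simp

lemma continuous_on_dual: "continuous_on S dual"
proof -
  have "continuous_on UNIV (\<lambda>l. - (- dual l))"
    by (intro continuous_on_minus convex_on_continuous convex_neg_dual open_UNIV)
  then show ?thesis
    using continuous_on_subset by auto
qed

text \<open>Concavity propagates the gap on a sphere around the maximizer to everything outside it.\<close>

lemma unique_dual_solution_gap:
  assumes sol: "dual_solution c A b X ls"
    and uniq: "\<And>l. dual_solution c A b X l \<Longrightarrow> l = ls"
    and "\<delta> > 0"
  obtains \<eta> where "\<eta> > 0" "\<And>l. 0 \<le> l \<Longrightarrow> \<delta> \<le> norm (l - ls) \<Longrightarrow> dual l + \<eta> \<le> dual ls"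
proof -
  define S where "S = {l. 0 \<le> l} \<inter> sphere ls \<delta>"
  have ls: "0 \<le> ls" "\<And>l. 0 \<le> l \<Longrightarrow> dual l \<le> dual ls"
    using sol unfolding dual_solution_def is_arg_max_def by (auto simp: not_less)
  have strict: "dual l < dual ls" if "0 \<le> l" "l \<noteq> ls" for l
  proof (rule ccontr)
    assume "\<not> dual l < dual ls"
    then have "dual_solution c A b X l"
      using that ls(2) unfolding dual_solution_def by (intro is_arg_maxI_le) force+
    then show False
      using uniq that by blast
  qed
  have orthant: "{l :: real ^ 'p. 0 \<le> l} = (\<Inter>j. {l. 0 \<le> l $ j})"
    by (auto simp: less_eq_vec_def)
  have "closed {l :: real ^ 'p. 0 \<le> l}"
    unfolding orthant by (intro closed_INT ballI closed_Collect_le continuous_intros)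
  then have "compact S"
    unfolding S_def by (intro closed_Int_compact) auto
  have "\<exists>\<eta>>0. \<forall>l\<in>S. dual l + \<eta> \<le> dual ls"
  proof (cases "S = {}")
    case False
    obtain s where s: "s \<in> S" "\<And>l. l \<in> S \<Longrightarrow> dual l \<le> dual s"
      using continuous_attains_sup[OF \<open>compact S\<close> False continuous_on_dual] by blast
    then have "dual s < dual ls"
      using \<open>\<delta> > 0\<close> by (intro strict) (auto simp: S_def)
    then show ?thesis
      using s(2) by (intro exI[of _ "dual ls - dual s"]) auto
  qed (auto intro: exI[of _ 1])
  then obtain \<eta> where \<eta>: "\<eta> > 0" "\<And>l. l \<in> S \<Longrightarrow> dual l + \<eta> \<le> dual ls"
    by blast
  have "dual l + \<eta> \<le> dual ls" if l: "0 \<le> l" "\<delta> \<le> norm (l - ls)" for l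
  proof -
    \<comment> \<open>\<open>s\<close> is the point where the segment from \<open>ls\<close> to
      \<open>l\<close> crosses the sphere.\<close>
    define t where "t = \<delta> / norm (l - ls)"
    define s where "s = (1 - t) *\<^sub>R ls + t *\<^sub>R l"
    have t: "0 < t" "t \<le> 1"
      using \<open>\<delta> > 0\<close> l(2) less_le_trans[OF \<open>\<delta> > 0\<close> l(2)] unfolding t_def by simp_all
    have "s - ls = t *\<^sub>R (l - ls)"
      unfolding s_def by (simp add: algebra_simps)
    then have "norm (s - ls) = \<delta>"
      using \<open>\<delta> > 0\<close> l(2) unfolding t_def by auto
    moreover have "0 \<le> s"
      using t ls(1) l(1) unfolding s_def less_eq_vec_def by auto
    ultimately have "s \<in> S"
      unfolding S_def by (auto simp: dist_norm norm_minus_commute)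
    moreover have "(1 - t) * dual ls + t * dual l \<le> dual s"
      using convex_onD[OF convex_neg_dual, of t ls l] t unfolding s_def by auto
    ultimately have "\<eta> \<le> t * (dual ls - dual l)"
      using \<eta>(2)[of s] by (simp add: algebra_simps)
    also have "\<dots> \<le> 1 * (dual ls - dual l)"
      using t ls(2)[OF l(1)] by (intro mult_right_mono) auto
    finally show ?thesis
      by simp
  qed
  then show ?thesis
    using \<eta>(1) that by blast
qed

text \<open>A vertex that is not optimal at \<open>l\<close> is strictly beaten by some point, which
  persists near \<open>l\<close>; there are only finitely many vertices. The filter is general
  because both the iterates and a ray of multipliers are used.\<close>

lemma eventually_face_subset:
  fixes f :: "'s \<Rightarrow> real ^ 'p"
  assumes "(f \<longlongrightarrow> l) F"
  shows "eventually (\<lambda>s. \<forall>i. vertices i \<inter> face (f s) i \<subseteq> face l i) F"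
proof -
  have "eventually (\<lambda>s. v \<notin> face (f s) i) F" if v: "v \<in> vertices i - face l i" for v i
  proof -
    obtain w where w: "w \<in> convex hull X i" "reduced_cost c A l i \<bullet> w < reduced_cost c A l i \<bullet> v"
      using v vertices_subset hull_subset[of "X i" convex] unfolding face_def
      by (auto simp: not_le)
    have "((\<lambda>s. reduced_cost c A (f s) i \<bullet> w - reduced_cost c A (f s) i \<bullet> v) \<longlongrightarrow>
        reduced_cost c A l i \<bullet> w - reduced_cost c A l i \<bullet> v) F"
      by (intro tendsto_diff tendsto_reduced_cost assms)
    then have "eventually (\<lambda>s. reduced_cost c A (f s) i \<bullet> w - reduced_cost c A (f s) i \<bullet> v < 0) F"
      by (rule order_tendstoD) (use w in simp)
    then show ?thesis
      by eventually_elim (use w(1) in \<open>auto simp: face_def not_le\<close>)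
  qed
  then have "eventually (\<lambda>s. \<forall>i\<in>UNIV. \<forall>v\<in>vertices i - face l i. v \<notin> face (f s) i) F"
    by (intro eventually_ball_finite ballI) (auto simp: finite_vertices vertices_def)
  then show ?thesis
    by eventually_elim blast
qed

end

text \<open>The linear map \<open>g\<close> sends the coordinate subspace of \<open>I\<close> into a
  space of smaller dimension, so it has a nonzero kernel vector there. Indexed coefficients also
  cover repeated values of \<open>f\<close>.\<close>

lemma linear_relation_if_card_gt_dim:
  fixes f :: "'m::finite \<Rightarrow> 'a::euclidean_space"
  assumes "DIM('a) < card I"
  obtains t :: "real ^ 'm" where "t \<noteq> 0" "\<And>i. i \<notin> I \<Longrightarrow> t $ i = 0" "(\<Sum>i\<in>UNIV. t $ i *\<^sub>R f i) = 0"
proof -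
  define S where "S = {t :: real ^ 'm. \<forall>b\<in>Basis. b \<notin> (\<lambda>i. axis i 1) ` I \<longrightarrow> t \<bullet> b = 0}"
  define g where "g t = (\<Sum>i\<in>UNIV. t $ i *\<^sub>R f i)" for t :: "real ^ 'm"
  have "linear g"
    unfolding g_def
    by (rule linearI) (simp_all add: scaleR_add_left sum.distrib scaleR_sum_right)
  have "subspace S"
    unfolding S_def by (auto simp: subspace_def inner_add_left)
  have "dim S = card ((\<lambda>i. axis i (1::real) :: real ^ 'm) ` I)"
    unfolding S_def by (rule dim_substandard) auto
  then have dimS: "dim S = card I"
    by (simp add: card_image inj_on_def axis_eq_axis)
  have "\<exists>t\<in>S. g t = 0 \<and> t \<noteq> 0"
  proof (rule ccontr)
    assume "\<not> ?thesis"
    then have "inj_on g S"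
      using linear_inj_on_iff_eq_0[OF \<open>linear g\<close> \<open>subspace S\<close>] by blast
    moreover have "span S = S"
      using \<open>subspace S\<close> by simp
    ultimately have "dim (g ` S) = dim S"
      using dim_image_eq[OF \<open>linear g\<close>, of S] by metis
    then show False
      using dim_subset_UNIV[of "g ` S"] dimS assms by simp
  qed
  then obtain t where t: "t \<in> S" "g t = 0" "t \<noteq> 0"
    by blast
  have "t $ i = 0" if "i \<notin> I" for i
  proof -
    have "axis i (1::real) \<notin> (\<lambda>i. axis i 1) ` I"
      using that by (auto simp: axis_eq_axis)
    then show ?thesis
      using t(1) unfolding S_def by (force simp: inner_axis Basis_vec_def)
  qed
  then show ?thesis
    using that t unfolding g_def by blast
qed

text \<open>For \<open>0 \<le> l\<close> this is the normal cone of the non-negative orthant at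
  \<open>l\<close>: the load excesses that are feasible and complementary to
  \<open>l\<close>.\<close>

definition slack_cone :: "real ^ 'p \<Rightarrow> (real ^ 'p) set" where
  "slack_cone l = {u. u \<le> 0 \<and> (\<forall>j. 0 < l $ j \<longrightarrow> u $ j = 0)}"

lemma zero_in_slack_cone: "0 \<in> slack_cone l"
  unfolding slack_cone_def by simp

lemma slack_cone_convex_comb:
  assumes "u \<in> slack_cone l" "v \<in> slack_cone l" "0 \<le> s" "0 \<le> t"
  shows "s *\<^sub>R u + t *\<^sub>R v \<in> slack_cone l"
  using assms unfolding slack_cone_def
  by (auto simp: less_eq_vec_def intro!: add_nonpos_nonpos mult_nonneg_nonpos)

lemma slack_cone_scaleR: "u \<in> slack_cone l \<Longrightarrow> 0 \<le> s \<Longrightarrow> s *\<^sub>R u \<in> slack_cone l"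
  using slack_cone_convex_comb[OF _ zero_in_slack_cone, of u l s 0] by simp

lemma neg_axis_in_slack_cone: "l $ j = 0 \<Longrightarrow> 0 \<le> t \<Longrightarrow> axis j (- t) \<in> slack_cone l"
  unfolding slack_cone_def by (auto simp: less_eq_vec_def axis_def)

lemma closed_slack_cone: "closed (slack_cone l)"
proof -
  have "slack_cone l = (\<Inter>j. {u. u $ j \<le> 0}) \<inter> (\<Inter>j\<in>{j. 0 < l $ j}. {u. u $ j = 0})"
    unfolding slack_cone_def by (auto simp: less_eq_vec_def)
  then show ?thesis
    by (simp only:)
      (intro closed_Int closed_INT ballI closed_Collect_le closed_Collect_eq continuous_intros)
qed

lemma inner_slack_cone_eq_0:
  assumes "0 \<le> l" "u \<in> slack_cone l"
  shows "l \<bullet> u = 0"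
  unfolding inner_vec_def
proof (rule sum.neutral, rule ballI)
  fix j
  show "l $ j \<bullet> u $ j = 0"
    using assms unfolding slack_cone_def less_eq_vec_def
    by (cases "l $ j = 0") (auto simp: less_le)
qed

section \<open>Optimality conditions and consequences of uniqueness\<close>

context coupled_lp
begin

text \<open>Sufficiency of the optimality conditions: complementarity removes the multiplier term,
  so the cost attains the lower bound of weak duality.\<close>

lemma face_slack_optimal:
  assumes "0 \<le> l" "\<And>i. z i \<in> face l i" "load A z - b \<in> slack_cone l"
  shows "lp_solution c A b X z" "total_cost c z = dual l"
proof -
  show eq: "total_cost c z = dual l"
    using dual_eq_lagrangian[OF assms(2)] inner_slack_cone_eq_0[OF assms(1,3)]
    unfolding lagrangian_def by simp
  have "coupled_feasible A b (\<lambda>i. convex hull X i) z"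
    using assms(2,3) face_subset_hull unfolding coupled_feasible_def load_def[symmetric] slack_cone_def
    by (auto simp: less_eq_vec_def)
  moreover have "total_cost c z \<le> total_cost c y"
    if "coupled_feasible A b (\<lambda>i. convex hull X i) y" for y
  proof -
    have y: "load A y - b \<le> 0" "\<And>i. y i \<in> convex hull X i"
      using that unfolding coupled_feasible_def load_def[symmetric] by (auto simp: less_eq_vec_def)
    have "l \<bullet> (load A y - b) \<le> 0"
      using y(1) assms(1) unfolding inner_vec_def less_eq_vec_def
      by (auto intro!: sum_nonpos mult_nonneg_nonpos)
    then show ?thesis
      using dual_le_lagrangian[OF y(2), of l] eq unfolding lagrangian_def by simp
  qed
  ultimately show "lp_solution c A b X z"
    unfolding lp_solution_def is_arg_min_def by (auto simp: not_less)
qed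

text \<open>A short move from \<open>ls\<close> along \<open>a\<close> stays non-negative and keeps
  the optimal vertices inside the faces at \<open>ls\<close>. If the slope there were non-negative,
  the moved multiplier would be a second dual solution.\<close>

lemma unique_dual_solution_descent:
  assumes sol: "dual_solution c A b X ls"
    and uniq: "\<And>l. dual_solution c A b X l \<Longrightarrow> l = ls"
    and a: "a \<noteq> 0" "\<And>j. ls $ j = 0 \<Longrightarrow> 0 \<le> a $ j"
  obtains v where "\<And>i. v i \<in> face ls i" "a \<bullet> (load A v - b) < 0"
proof -
  have ls: "0 \<le> ls" "\<And>l. 0 \<le> l \<Longrightarrow> dual l \<le> dual ls"
    using sol unfolding dual_solution_def is_arg_max_def by (auto simp: not_less)
  have lim: "((\<lambda>t. ls + t *\<^sub>R a) \<longlongrightarrow> ls + 0 *\<^sub>R a) (at_right 0)"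
    by (intro tendsto_intros)
  have pos: "eventually (\<lambda>t::real. 0 < t) (at_right 0)"
    by (auto simp: eventually_at_right_less)
  have "eventually (\<lambda>t. 0 \<le> (ls + t *\<^sub>R a) $ j) (at_right 0)" for j
  proof (cases "ls $ j = 0")
    case True
    then show ?thesis
      using a(2) by (intro eventually_mono[OF pos]) auto
  next
    case False
    then have "0 < (ls + 0 *\<^sub>R a) $ j"
      using ls(1) by (simp add: less_eq_vec_def less_le)
    then have "eventually (\<lambda>t. 0 < (ls + t *\<^sub>R a) $ j) (at_right 0)"
      using order_tendstoD(1)[OF tendsto_vec_nth[OF lim]] by blast
    then show ?thesis
      by eventually_elim (rule less_imp_le)
  qed
  then have "eventually (\<lambda>t. \<forall>j. 0 \<le> (ls + t *\<^sub>R a) $ j) (at_right 0)"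
    by (rule eventually_all_finite)
  moreover have "eventually (\<lambda>t. \<forall>i. vertices i \<inter> face (ls + t *\<^sub>R a) i \<subseteq> face ls i) (at_right 0)"
    using eventually_face_subset[OF lim] by simp
  ultimately have "eventually (\<lambda>t. 0 < t \<and> (\<forall>j. 0 \<le> (ls + t *\<^sub>R a) $ j) \<and>
      (\<forall>i. vertices i \<inter> face (ls + t *\<^sub>R a) i \<subseteq> face ls i)) (at_right 0)"
    using pos by eventually_elim blast
  then obtain t where t: "0 < t" "0 \<le> ls + t *\<^sub>R a"
    "\<And>i. vertices i \<inter> face (ls + t *\<^sub>R a) i \<subseteq> face ls i"
    using eventually_happens'[OF trivial_limit_at_right_real] by (force simp: less_eq_vec_def)
  obtain v where v: "\<And>i. v i \<in> face (ls + t *\<^sub>R a) i" "\<And>i. v i \<in> vertices i"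
    using obtain_face_vertices by blast
  then have face: "v i \<in> face ls i" for i
    using t(3) by blast
  have "a \<bullet> (load A v - b) < 0"
  proof (rule ccontr)
    assume "\<not> ?thesis"
    then have "dual ls \<le> dual (ls + t *\<^sub>R a)"
      using t(1) lagrangian_split[of c A b "ls + t *\<^sub>R a" v ls]
      unfolding dual_eq_lagrangian[OF v(1)] dual_eq_lagrangian[OF face] by (simp add: not_less)
    then have "dual_solution c A b X (ls + t *\<^sub>R a)"
      using t(2) ls(2) unfolding dual_solution_def by (intro is_arg_maxI_le) force+
    then show False
      using uniq t(1) a(1) by fastforce
  qed
  then show ?thesis
    using that face by blast
qed

text \<open>Uniqueness of the multiplier is a strict complementarity statement: every point of the optimal
  faces is a part of some optimal point.\<close>

lemma unique_dual_solution_interior: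
  assumes sol: "dual_solution c A b X ls"
    and uniq: "\<And>l. dual_solution c A b X l \<Longrightarrow> l = ls"
    and z0: "\<And>i. z0 i \<in> face ls i"
  obtains y \<theta> where "0 < \<theta>" "\<theta> < 1" "\<And>i. y i \<in> face ls i"
    "load A (\<lambda>i. (1 - \<theta>) *\<^sub>R y i + \<theta> *\<^sub>R z0 i) - b \<in> slack_cone ls"
proof -
  \<comment> \<open>\<open>0 \<in> M\<close> says that some point of the faces has a complementary
    load; a relatively interior 0 gives this with room in every direction of
    \<open>M\<close>.\<close>
  define M where "M = {load A z - b - q | z q. (\<forall>i. z i \<in> face ls i) \<and> q \<in> slack_cone ls}"
  have MI: "load A z - b - q \<in> M" if "\<And>i. z i \<in> face ls i" "q \<in> slack_cone ls" for z q
    using that unfolding M_def by blast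
  have "convex M"
  proof (rule convexI)
    fix x y :: "real ^ 'p" and u v :: real
    assume *: "x \<in> M" "y \<in> M" "0 \<le> u" "0 \<le> v" "u + v = 1"
    obtain z q z' q' where zq: "x = load A z - b - q" "y = load A z' - b - q'"
      "\<And>i. z i \<in> face ls i" "\<And>i. z' i \<in> face ls i" "q \<in> slack_cone ls" "q' \<in> slack_cone ls"
      using *(1,2) unfolding M_def by blast
    have "b = u *\<^sub>R b + v *\<^sub>R b"
      using *(5) by (simp flip: scaleR_add_left)
    then have "u *\<^sub>R x + v *\<^sub>R y = load A (\<lambda>i. u *\<^sub>R z i + v *\<^sub>R z' i) - b - (u *\<^sub>R q + v *\<^sub>R q')"
      unfolding zq load_convex_comb by (simp add: algebra_simps)
    also have "\<dots> \<in> M"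
      using zq * by (intro MI convexD[OF convex_face] slack_cone_convex_comb) auto
    finally show "u *\<^sub>R x + v *\<^sub>R y \<in> M" .
  qed
  \<comment> \<open>Directions that keep \<open>ls + t *\<^sub>R a\<close> non-negative for small
    \<open>t\<close> use dual uniqueness; for the others the slack cone itself supplies the negative
    value.\<close>
  moreover have "\<exists>m\<in>M. a \<bullet> m < 0" if nz: "a \<noteq> 0" for a
  proof (cases "\<forall>j. ls $ j = 0 \<longrightarrow> 0 \<le> a $ j")
    case True
    then obtain v where "\<And>i. v i \<in> face ls i" "a \<bullet> (load A v - b) < 0"
      using unique_dual_solution_descent[OF sol uniq nz] by blast
    then show ?thesis
      using MI[of v 0] zero_in_slack_cone by auto
  next
    case False
    then obtain j where j: "ls $ j = 0" "a $ j < 0"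
      by (auto simp: not_le)
    \<comment> \<open>The length is chosen so that the slack term outweighs the load excess of
      \<open>z0\<close>, with 1 to spare for strictness.\<close>
    define t where "t = (\<bar>a \<bullet> (load A z0 - b)\<bar> + 1) / (- a $ j)"
    have "0 \<le> t"
      unfolding t_def using j by (intro divide_nonneg_pos) auto
    have "t * a $ j = - (\<bar>a \<bullet> (load A z0 - b)\<bar> + 1)"
      unfolding t_def using j by (simp add: field_simps)
    then have "a \<bullet> (load A z0 - b - axis j (- t)) < 0"
      by (simp add: inner_diff_right inner_axis mult.commute)
    then show ?thesis
      using MI[OF z0 neg_axis_in_slack_cone[OF j(1) \<open>0 \<le> t\<close>]] by blast
  qed
  ultimately have "0 \<in> rel_interior M"
    by (rule zero_in_rel_interior)
  moreover have m0: "load A z0 - b \<in> M"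
    using MI[OF z0 zero_in_slack_cone] by simp
  \<comment> \<open>The segment from the load excess of \<open>z0\<close> to 0 extends beyond 0
    within \<open>M\<close>. The weight \<open>\<theta>\<close> below is the one at which mixing the
    far end with \<open>z0\<close> returns to 0.\<close>
  ultimately obtain e where e: "e > 1" "(1 - e) *\<^sub>R (load A z0 - b) + e *\<^sub>R 0 \<in> M"
    using convex_rel_interior_iff[OF \<open>convex M\<close>] by blast
  then obtain y q where y: "(1 - e) *\<^sub>R (load A z0 - b) = load A y - b - q"
    "\<And>i. y i \<in> face ls i" "q \<in> slack_cone ls"
    unfolding M_def by auto
  define \<theta> where "\<theta> = 1 - 1 / e"
  have \<theta>: "0 < \<theta>" "\<theta> < 1" "1 - \<theta> = 1 / e" "(1 / e) * (1 - e) = - \<theta>"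
    using e(1) unfolding \<theta>_def by (auto simp: field_simps)
  have "(1 / e) *\<^sub>R (load A y - b) = (1 / e) *\<^sub>R ((1 - e) *\<^sub>R (load A z0 - b) + q)"
    using y(1) by simp
  then have "(1 - \<theta>) *\<^sub>R (load A y - b) + \<theta> *\<^sub>R (load A z0 - b) = (1 / e) *\<^sub>R q"
    unfolding \<theta>(3) scaleR_add_right scaleR_scaleR \<theta>(4) by simp
  then have "load A (\<lambda>i. (1 - \<theta>) *\<^sub>R y i + \<theta> *\<^sub>R z0 i) - b = (1 / e) *\<^sub>R q"
    unfolding load_convex_comb by (simp add: algebra_simps)
  also have "\<dots> \<in> slack_cone ls"
    using e(1) by (intro slack_cone_scaleR y(3)) auto
  finally show ?thesis
    using that \<theta>(1,2) y(2) by blast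
qed

text \<open>Strong duality: mixing any face points as in
  \<open>unique_dual_solution_interior\<close> gives a primal solution with the dual value, which
  uniqueness identifies with \<open>xs\<close>.\<close>

lemma unique_solutions_face:
  assumes sol: "dual_solution c A b X ls"
    and uniq: "\<And>l. dual_solution c A b X l \<Longrightarrow> l = ls"
    and uniq_primal: "\<And>z. lp_solution c A b X z \<Longrightarrow> z = xs"
  shows "xs i \<in> face ls i" "total_cost c xs = dual ls"
proof -
  have "0 \<le> ls"
    using sol unfolding dual_solution_def is_arg_max_def by simp
  obtain z0 where z0: "\<And>i. z0 i \<in> face ls i"
    using obtain_face_vertices by blast
  obtain y \<theta> where y: "0 < \<theta>" "\<theta> < 1" "\<And>i. y i \<in> face ls i"
    "load A (\<lambda>i. (1 - \<theta>) *\<^sub>R y i + \<theta> *\<^sub>R z0 i) - b \<in> slack_cone ls"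
    using unique_dual_solution_interior[OF sol uniq z0] by blast
  have face: "(1 - \<theta>) *\<^sub>R y i + \<theta> *\<^sub>R z0 i \<in> face ls i" for i
    using y(1,2) by (intro convexD[OF convex_face] y(3) z0) auto
  note opt = face_slack_optimal[OF \<open>0 \<le> ls\<close> face y(4)]
  then have "xs = (\<lambda>i. (1 - \<theta>) *\<^sub>R y i + \<theta> *\<^sub>R z0 i)"
    using uniq_primal by blast
  then show "xs i \<in> face ls i" "total_cost c xs = dual ls"
    using face opt by auto
qed

text \<open>If more than \<open>p\<close> faces were nontrivial, a linear relation between the loads of one direction in each
  of them would allow moving an optimal point without changing its load.\<close>

lemma card_nontrivial_faces:
  assumes sol: "dual_solution c A b X ls"
    and uniq: "\<And>l. dual_solution c A b X l \<Longrightarrow> l = ls"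
    and uniq_primal: "\<And>z. lp_solution c A b X z \<Longrightarrow> z = xs"
  shows "card {i. face ls i \<noteq> {xs i}} \<le> CARD('p)"
proof (rule ccontr)
  define I where "I = {i. face ls i \<noteq> {xs i}}"
  assume "\<not> ?thesis"
  then have card: "DIM(real ^ 'p) < card I"
    unfolding I_def by simp
  have ls: "0 \<le> ls"
    using sol unfolding dual_solution_def is_arg_max_def by simp
  note xs = unique_solutions_face(1)[OF sol uniq uniq_primal]
  have "\<exists>v. v \<in> face ls i \<and> (i \<in> I \<longrightarrow> v \<noteq> xs i)" for i
    using xs[of i] unfolding I_def by (cases "face ls i = {xs i}") auto
  then obtain v where v: "\<And>i. v i \<in> face ls i" "\<And>i. i \<in> I \<Longrightarrow> v i \<noteq> xs i"
    by metis
  obtain t0 :: "real ^ 'm" where t0: "t0 \<noteq> 0" "\<And>i. i \<notin> I \<Longrightarrow> t0 $ i = 0"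
    "(\<Sum>i\<in>UNIV. t0 $ i *\<^sub>R (A i *v (v i - xs i))) = 0"
    using linear_relation_if_card_gt_dim[OF card, of "\<lambda>i. A i *v (v i - xs i)"] by blast
  \<comment> \<open>Normalising gives \<open>\<bar>t $ i\<bar> \<le> 1\<close>, which makes the
    weights of \<open>z s\<close> below non-negative.\<close>
  define t where "t = (1 / norm t0) *\<^sub>R t0"
  have t: "\<bar>t $ i\<bar> \<le> 1" for i
    using t0(1) component_le_norm_cart[of t0 i] unfolding t_def by (simp add: field_simps abs_mult)
  have rel: "(\<Sum>i\<in>UNIV. t $ i *\<^sub>R (A i *v (v i - xs i))) = 0"
    using arg_cong[OF t0(3), of "\<lambda>w. (1 / norm t0) *\<^sub>R w"] unfolding t_def
    by (simp add: scaleR_sum_right)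
  \<comment> \<open>\<open>z 0\<close> is the midpoint of \<open>v\<close> and \<open>xs\<close>;
    \<open>z 1\<close> is shifted along the relation, which leaves the total load unchanged.\<close>
  define z where "z s = (\<lambda>i. ((1 + s * t $ i) / 2) *\<^sub>R v i + ((1 - s * t $ i) / 2) *\<^sub>R xs i)" for s :: real
  have z_face: "z s i \<in> face ls i" if "s \<in> {0, 1}" for s i
    unfolding z_def using that t[of i]
    by (intro convexD[OF convex_face] v xs)
      (auto simp: abs_le_iff add_divide_distrib diff_divide_distrib)
  have z_shift: "z 1 i = z 0 i + (1 / 2) *\<^sub>R (t $ i *\<^sub>R (v i - xs i))" for i
    unfolding z_def by (simp add: algebra_simps add_divide_distrib diff_divide_distrib)
  have "A i *v z 1 i = A i *v z 0 i + (1 / 2) *\<^sub>R (t $ i *\<^sub>R (A i *v (v i - xs i)))" for i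
    by (simp only: z_shift matrix_vector_right_distrib matrix_vector_mult_scaleR)
  then have "load A (z 1) = load A (z 0) + (1 / 2) *\<^sub>R (\<Sum>i\<in>UNIV. t $ i *\<^sub>R (A i *v (v i - xs i)))"
    unfolding load_def by (simp only: sum.distrib scaleR_sum_right)
  then have load_eq: "load A (z 1) = load A (z 0)"
    using rel by simp
  obtain y \<theta> where y: "0 < \<theta>" "\<theta> < 1" "\<And>i. y i \<in> face ls i"
    "load A (\<lambda>i. (1 - \<theta>) *\<^sub>R y i + \<theta> *\<^sub>R z 0 i) - b \<in> slack_cone ls"
    using unique_dual_solution_interior[OF sol uniq z_face[of 0]] by blast
  \<comment> \<open>Equal loads let the same \<open>y\<close> and \<open>\<theta>\<close> complete
    both \<open>z 0\<close> and \<open>z 1\<close> to solutions; as \<open>0 < \<theta>\<close>,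
    uniqueness forces the shift to vanish.\<close>
  have "lp_solution c A b X (\<lambda>i. (1 - \<theta>) *\<^sub>R y i + \<theta> *\<^sub>R z s i)" if "s \<in> {0, 1}" for s
  proof (rule face_slack_optimal[OF ls])
    show "(1 - \<theta>) *\<^sub>R y i + \<theta> *\<^sub>R z s i \<in> face ls i" for i
      using y(1,2) by (intro convexD[OF convex_face] y(3) z_face that) auto
    show "load A (\<lambda>i. (1 - \<theta>) *\<^sub>R y i + \<theta> *\<^sub>R z s i) - b \<in> slack_cone ls"
      using y(4) that load_eq unfolding load_convex_comb by auto
  qed
  then have eq: "(\<lambda>i. (1 - \<theta>) *\<^sub>R y i + \<theta> *\<^sub>R z s i) = xs" if "s \<in> {0, 1}" for s
    using uniq_primal that by blast
  have "t $ i *\<^sub>R (v i - xs i) = 0" for i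
  proof -
    have "(1 - \<theta>) *\<^sub>R y i + \<theta> *\<^sub>R z 0 i = (1 - \<theta>) *\<^sub>R y i + \<theta> *\<^sub>R z 1 i"
      using fun_cong[OF eq[of 0], of i] fun_cong[OF eq[of 1], of i] by simp
    then have "z 0 i = z 1 i"
      using y(1) by simp
    then show ?thesis
      using z_shift[of i] by simp
  qed
  then have "t0 $ i = 0" for i
    using v(2) t0(1,2) unfolding t_def by (cases "i \<in> I") auto
  then show False
    using t0(1) by (simp add: vec_eq_iff)
qed

section \<open>Asymptotics of the multipliers and of the visited vertices\<close>

lemma finite_vertex_loads: "finite {load A z - b | z. \<forall>i. z i \<in> vertices i}"
proof -
  have "{load A z - b | z. \<forall>i. z i \<in> vertices i} \<subseteq> (\<lambda>z. load A z - b) ` (PiE UNIV vertices)"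
    by auto
  moreover have "finite (PiE UNIV vertices)"
    by (intro finite_PiE) (auto simp: vertices_def finite_vertices)
  ultimately show ?thesis
    using finite_subset by blast
qed

text \<open>The projected subgradient argument: the squared distance to \<open>ls\<close> drops by
  \<open>2 * \<alpha> k\<close> times the dual gap, up to a quadratic error. Uniqueness bounds the
  gap below away from \<open>ls\<close>.\<close>

lemma multipliers_converge:
  fixes lam :: "nat \<Rightarrow> real ^ 'p"
  assumes sol: "dual_solution c A b X ls"
    and uniq: "\<And>l. dual_solution c A b X l \<Longrightarrow> l = ls"
    and step_pos: "\<And>k. \<alpha> k > 0"
    and step_lim: "\<alpha> \<longlonglongrightarrow> 0"
    and step_sum: "filterlim (\<lambda>N. \<Sum>k<N. \<alpha> k) at_top sequentially"
    and lam_nonneg: "\<And>k. 0 \<le> lam k"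
    and w: "\<And>k i. w k i \<in> face (lam k) i" "\<And>k i. w k i \<in> vertices i"
    and step: "eventually (\<lambda>k. lam (Suc k) =
      (\<chi> j. max 0 ((lam k + \<alpha> k *\<^sub>R (load A (w k) - b)) $ j))) sequentially"
  shows "lam \<longlonglongrightarrow> ls"
proof -
  have ls: "0 \<le> ls" "\<And>l. 0 \<le> l \<Longrightarrow> dual l \<le> dual ls"
    using sol unfolding dual_solution_def is_arg_max_def by (auto simp: not_less)
  obtain B where B: "\<And>u. u \<in> {load A z - b | z. \<forall>i. z i \<in> vertices i} \<Longrightarrow> norm u \<le> B"
    using finite_imp_bounded[OF finite_vertex_loads] unfolding bounded_iff by blast
  define D where "D k = (norm (lam k - ls))\<^sup>2" for k
  define h where "h k = dual ls - dual (lam k)" for k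
  have "eventually (\<lambda>k. D (Suc k) \<le> D k - 2 * \<alpha> k * h k + (\<alpha> k)\<^sup>2 * B\<^sup>2) sequentially"
    using step
  proof eventually_elim
    case (elim k)
    define g where "g = load A (w k) - b"
    have "norm g \<le> B"
      unfolding g_def using w(2) by (intro B) auto
    then have "(norm g)\<^sup>2 \<le> B\<^sup>2"
      by (intro power_mono) auto
    then have sq: "(\<alpha> k)\<^sup>2 * (norm g)\<^sup>2 \<le> (\<alpha> k)\<^sup>2 * B\<^sup>2"
      by (intro mult_left_mono) auto
    \<comment> \<open>The subgradient inequality: \<open>w k\<close> minimises the Lagrangian at
      \<open>lam k\<close> and is a competitor at \<open>ls\<close>.\<close>
    have "dual ls \<le> lagr ls (w k)"
      using w(1) face_subset_hull by (intro dual_le_lagrangian) blast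
    also have "\<dots> = dual (lam k) + (ls - lam k) \<bullet> g"
      unfolding dual_eq_lagrangian[OF w(1)] g_def by (rule lagrangian_split)
    finally have "(lam k - ls) \<bullet> g \<le> - h k"
      unfolding h_def by (simp add: inner_diff_left)
    then have cross: "\<alpha> k * ((lam k - ls) \<bullet> g) \<le> \<alpha> k * - h k"
      using step_pos[of k] by (intro mult_left_mono) auto
    have "norm (lam (Suc k) - ls) \<le> norm (lam k + \<alpha> k *\<^sub>R g - ls)"
      unfolding elim g_def[symmetric] by (rule dist_pos_part_le[OF ls(1)])
    then have "D (Suc k) \<le> (norm (lam k + \<alpha> k *\<^sub>R g - ls))\<^sup>2"
      unfolding D_def by (intro power_mono) auto
    also have "lam k + \<alpha> k *\<^sub>R g - ls = (lam k - ls) + \<alpha> k *\<^sub>R g"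
      by simp
    also have "(norm \<dots>)\<^sup>2 = D k + 2 * (\<alpha> k * ((lam k - ls) \<bullet> g)) + (\<alpha> k)\<^sup>2 * (norm g)\<^sup>2"
      unfolding D_def power2_norm_eq_inner
      by (simp add: inner_add_left inner_add_right inner_commute power2_eq_square algebra_simps)
    finally show ?case
      using sq cross by simp
  qed
  moreover have "0 \<le> h k" for k
    using ls(2)[OF lam_nonneg] unfolding h_def by simp
  moreover have "\<exists>\<eta>>0. \<forall>k. \<delta> \<le> D k \<longrightarrow> \<eta> \<le> h k" if "\<delta> > 0" for \<delta>
  proof -
    have "sqrt \<delta> > 0"
      using that by simp
    then obtain \<eta> where \<eta>: "\<eta> > 0"
      "\<And>l. 0 \<le> l \<Longrightarrow> sqrt \<delta> \<le> norm (l - ls) \<Longrightarrow> dual l + \<eta> \<le> dual ls"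
      using unique_dual_solution_gap[OF sol uniq] by blast
    have "\<eta> \<le> h k" if "\<delta> \<le> D k" for k
    proof -
      have "sqrt \<delta> \<le> norm (lam k - ls)"
        using that unfolding D_def by (rule real_le_lsqrt[OF norm_ge_zero])
      then show ?thesis
        using \<eta>(2)[OF lam_nonneg] unfolding h_def by force
    qed
    then show ?thesis
      using \<eta>(1) by blast
  qed
  ultimately have "D \<longlonglongrightarrow> 0"
    by (intro diminishing_step_tendsto_zero[where h = h and G = "B\<^sup>2", OF _ step_pos step_lim step_sum])
      (auto simp: D_def)
  then have "(\<lambda>k. sqrt (D k)) \<longlonglongrightarrow> sqrt 0"
    by (rule tendsto_real_sqrt)
  then show ?thesis
    unfolding D_def by (simp add: tendsto_norm_zero_iff LIM_zero_iff)
qed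

text \<open>If the conclusion failed, a hyperplane would separate the loads of the iterates from the slack cone,
  and the multipliers would drift to infinity along its normal.\<close>

lemma visited_hull_slack:
  fixes lam :: "nat \<Rightarrow> real ^ 'p"
  assumes ls: "0 \<le> ls"
    and lim: "lam \<longlonglongrightarrow> ls"
    and step_pos: "\<And>k. \<alpha> k > 0"
    and step_sum: "filterlim (\<lambda>N. \<Sum>k<N. \<alpha> k) at_top sequentially"
    and w: "\<And>k i. w k i \<in> vertices i"
    and step: "eventually (\<lambda>k. lam (Suc k) =
      (\<chi> j. max 0 ((lam k + \<alpha> k *\<^sub>R (load A (w k) - b)) $ j))) sequentially"
  obtains y where "\<And>i. y i \<in> convex hull {w k i | k. k \<ge> K}" "load A y - b \<in> slack_cone ls"
proof -
  have "eventually (\<lambda>k. \<forall>j. 0 < ls $ j \<longrightarrow> 0 < lam k $ j) sequentially"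
  proof (rule eventually_all_finite)
    show "eventually (\<lambda>k. 0 < ls $ j \<longrightarrow> 0 < lam k $ j) sequentially" for j
      using order_tendstoD(1)[OF tendsto_vec_nth[OF lim], of 0 j] by (cases "0 < ls $ j") auto
  qed
  with step have "eventually (\<lambda>k. k \<ge> K \<and> (\<forall>j. 0 < ls $ j \<longrightarrow> 0 < lam k $ j) \<and>
      lam (Suc k) = (\<chi> j. max 0 ((lam k + \<alpha> k *\<^sub>R (load A (w k) - b)) $ j))) sequentially"
    using eventually_ge_at_top[of K] by eventually_elim blast
  then obtain N where N: "N \<ge> K" "\<And>k j. k \<ge> N \<Longrightarrow> 0 < ls $ j \<Longrightarrow> 0 < lam k $ j"
    "\<And>k. k \<ge> N \<Longrightarrow> lam (Suc k) = (\<chi> j. max 0 ((lam k + \<alpha> k *\<^sub>R (load A (w k) - b)) $ j))"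
    unfolding eventually_sequentially by blast
  \<comment> \<open>\<open>T\<close> is finite, so its hull is compact and can be strictly separated
    from the closed cone. \<open>H\<close> allows each agent its own convex weights and therefore
    contains that hull.\<close>
  define T where "T = {load A (w k) - b | k. k \<ge> N}"
  define H where "H = {load A y - b | y. \<forall>i. y i \<in> convex hull {w k i | k. k \<ge> K}}"
  have "finite T"
    by (rule finite_subset[OF _ finite_vertex_loads]) (use w in \<open>auto simp: T_def\<close>)
  have "convex H"
  proof (rule convexI)
    fix p q :: "real ^ 'p" and u v :: real
    assume *: "p \<in> H" "q \<in> H" "0 \<le> u" "0 \<le> v" "u + v = 1"
    then obtain y z where yz: "p = load A y - b" "q = load A z - b"
      "\<And>i. y i \<in> convex hull {w k i | k. k \<ge> K}" "\<And>i. z i \<in> convex hull {w k i | k. k \<ge> K}"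
      unfolding H_def by blast
    have "b = u *\<^sub>R b + v *\<^sub>R b"
      using *(5) by (simp flip: scaleR_add_left)
    then have "u *\<^sub>R p + v *\<^sub>R q = load A (\<lambda>i. u *\<^sub>R y i + v *\<^sub>R z i) - b"
      unfolding yz load_convex_comb by (simp add: algebra_simps)
    moreover have "u *\<^sub>R y i + v *\<^sub>R z i \<in> convex hull {w k i | k. k \<ge> K}" for i
      using * yz by (intro convexD[OF convex_convex_hull]) auto
    ultimately show "u *\<^sub>R p + v *\<^sub>R q \<in> H"
      unfolding H_def by blast
  qed
  moreover have "T \<subseteq> H"
  proof
    fix u assume "u \<in> T"
    then obtain k where k: "u = load A (w k) - b" "k \<ge> K"
      using N(1) unfolding T_def by auto
    then have "w k i \<in> convex hull {w k i | k. k \<ge> K}" for i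
      by (intro hull_inc) blast
    then show "u \<in> H"
      using k(1) unfolding H_def by blast
  qed
  ultimately have hull_T: "convex hull T \<subseteq> H"
    by (intro hull_minimal)
  have "convex hull T \<inter> slack_cone ls \<noteq> {}"
  proof
    assume disj: "convex hull T \<inter> slack_cone ls = {}"
    have "convex hull T \<noteq> {}"
      unfolding T_def by auto
    moreover have "convex (slack_cone ls)"
      by (rule convexI) (rule slack_cone_convex_comb)
    moreover have "compact (convex hull T)"
      using \<open>finite T\<close> by (rule finite_imp_compact_convex_hull)
    ultimately obtain a \<beta> where "\<forall>u\<in>convex hull T. a \<bullet> u < \<beta>" "\<forall>u\<in>slack_cone ls. \<beta> < a \<bullet> u"
      using separating_hyperplane_compact_closed[OF convex_convex_hull _ _ _ closed_slack_cone disj]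
      by blast
    then have a: "\<And>u. u \<in> T \<Longrightarrow> a \<bullet> u < \<beta>" "\<And>u. u \<in> slack_cone ls \<Longrightarrow> \<beta> < a \<bullet> u"
      using hull_inc[of _ T convex] by blast+
    have "\<beta> < 0"
      using a(2)[OF zero_in_slack_cone] by simp
    have a_nonpos: "a $ j \<le> 0" if "ls $ j = 0" for j
    proof (rule ccontr)
      assume "\<not> ?thesis"
      then have j: "0 < a $ j"
        by simp
      \<comment> \<open>The witness is scaled to make the inner product exactly
        \<open>\<beta>\<close>.\<close>
      have "\<beta> < a \<bullet> axis j (- (- \<beta> / a $ j))"
        using \<open>\<beta> < 0\<close> j that by (intro a(2) neg_axis_in_slack_cone) (auto simp: field_simps)
      then show False
        using j by (simp add: inner_axis)
    qed
    have drift: "a \<bullet> lam (Suc k) \<le> a \<bullet> lam k + \<alpha> k * \<beta>" if k: "k \<ge> N" for k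
    proof -
      \<comment> \<open>Truncation only raises coordinates, which is harmless where
        \<open>a $ j \<le> 0\<close>. Where \<open>ls $ j\<close> is positive the new multiplier is
        positive too, so nothing was truncated.\<close>
      have "a $ j * lam (Suc k) $ j \<le> a $ j * (lam k + \<alpha> k *\<^sub>R (load A (w k) - b)) $ j" for j
      proof (cases "ls $ j = 0")
        case True
        then show ?thesis
          unfolding N(3)[OF k] by (intro mult_left_mono_neg a_nonpos) auto
      next
        case False
        then have "0 < ls $ j"
          using ls by (simp add: less_eq_vec_def less_le)
        then have "0 < lam (Suc k) $ j"
          using N(2)[of "Suc k" j] k by simp
        then show ?thesis
          unfolding N(3)[OF k] by (simp add: max_def split: if_splits)
      qed
      then have "a \<bullet> lam (Suc k) \<le> a \<bullet> (lam k + \<alpha> k *\<^sub>R (load A (w k) - b))"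
        unfolding inner_vec_def by (intro sum_mono) simp
      also have "\<dots> \<le> a \<bullet> lam k + \<alpha> k * \<beta>"
      proof -
        have "load A (w k) - b \<in> T"
          using k unfolding T_def by blast
        then have "\<alpha> k * (a \<bullet> (load A (w k) - b)) \<le> \<alpha> k * \<beta>"
          using a(1) step_pos[of k] by (intro mult_left_mono) (auto intro: less_imp_le)
        then show ?thesis
          by (simp add: inner_add_right)
      qed
      finally show ?thesis .
    qed
    have sum: "a \<bullet> lam (N + n) \<le> a \<bullet> lam N + \<beta> * ((\<Sum>k<N + n. \<alpha> k) - (\<Sum>k<N. \<alpha> k))" for n
    proof (induction n)
      case (Suc n)
      then show ?case
        using drift[of "N + n"] by (simp add: right_diff_distrib distrib_left mult.commute)
    qed simp
    have "(\<lambda>k. a \<bullet> lam k) \<longlonglongrightarrow> a \<bullet> ls"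
      by (intro tendsto_intros lim)
    then have "eventually (\<lambda>k. a \<bullet> ls - 1 < a \<bullet> lam k) sequentially"
      by (rule order_tendstoD) simp
    \<comment> \<open>Past this step sum the accumulated drift has taken
      \<open>a \<bullet> lam\<close> to \<open>a \<bullet> ls - 1\<close> or lower, against
      convergence.\<close>
    moreover have "eventually (\<lambda>n. (a \<bullet> lam N - (a \<bullet> ls - 1)) / - \<beta> + (\<Sum>k<N. \<alpha> k) < (\<Sum>k<n. \<alpha> k)) sequentially"
      using step_sum unfolding filterlim_at_top_dense by blast
    ultimately have "eventually (\<lambda>k. a \<bullet> ls - 1 < a \<bullet> lam k \<and>
        (a \<bullet> lam N - (a \<bullet> ls - 1)) / - \<beta> + (\<Sum>k<N. \<alpha> k) < (\<Sum>i<k. \<alpha> i)) sequentially"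
      by (rule eventually_conj)
    then obtain n where n: "\<And>k. k \<ge> n \<Longrightarrow> a \<bullet> ls - 1 < a \<bullet> lam k"
      "\<And>k. k \<ge> n \<Longrightarrow> (a \<bullet> lam N - (a \<bullet> ls - 1)) / - \<beta> + (\<Sum>k<N. \<alpha> k) < (\<Sum>i<k. \<alpha> i)"
      unfolding eventually_sequentially by blast
    have "(a \<bullet> lam N - (a \<bullet> ls - 1)) / - \<beta> < (\<Sum>k<N + n. \<alpha> k) - (\<Sum>k<N. \<alpha> k)"
      using n(2)[of "N + n"] by simp
    then have "a \<bullet> lam N - (a \<bullet> ls - 1) < ((\<Sum>k<N + n. \<alpha> k) - (\<Sum>k<N. \<alpha> k)) * - \<beta>"
      using \<open>\<beta> < 0\<close> by (subst (asm) pos_divide_less_eq) auto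
    then show False
      using sum[of n] n(1)[of "N + n"] by (simp add: mult.commute)
  qed
  then show ?thesis
    using hull_T that unfolding H_def by blast
qed

end

section \<open>Spreads of the visited points\<close>

definition spread :: "('a \<Rightarrow> real) \<Rightarrow> 'a set \<Rightarrow> real" where
  "spread f S = Max (f ` S) - Min (f ` S)"

text \<open>A linear function does not fall below its minimum over \<open>S\<close> anywhere on the
  hull, so \<open>y\<close> may be fractional.\<close>

lemma diff_le_spread_hull:
  fixes f :: "'a::real_vector \<Rightarrow> real"
  assumes "linear f" "finite S" "v \<in> S" "y \<in> convex hull S"
  shows "f v - f y \<le> spread f S"
proof -
  have "convex (f -` {Min (f ` S)..})"
    using assms(1) by (intro convex_linear_vimage) auto
  then have "convex hull S \<subseteq> f -` {Min (f ` S)..}"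
    using assms(2) by (intro hull_minimal) auto
  then have "Min (f ` S) \<le> f y"
    using assms(4) by auto
  moreover have "f v \<le> Max (f ` S)"
    using assms(2,3) by simp
  ultimately show ?thesis
    unfolding spread_def by simp
qed

lemma spread_nonneg:
  fixes f :: "'a::real_vector \<Rightarrow> real"
  assumes "finite S" "S \<noteq> {}"
  shows "0 \<le> spread f S"
  using assms unfolding spread_def by (simp add: Min_le_iff Max_ge_iff)

lemma inner_diff_le_hull_spread:
  fixes c :: "'a::real_inner"
  assumes "bounded S" "u \<in> convex hull S" "v \<in> convex hull S"
  shows "c \<bullet> u - c \<bullet> v \<le> (SUP x\<in>S. c \<bullet> x) - (INF x\<in>S. c \<bullet> x)"
proof -
  have "bounded ((\<lambda>x. c \<bullet> x) ` S)"
    using assms(1) by (intro bounded_linear_image bounded_linear_inner_right)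
  then have bdd: "bdd_above ((\<lambda>x. c \<bullet> x) ` S)" "bdd_below ((\<lambda>x. c \<bullet> x) ` S)"
    by (auto intro: bounded_imp_bdd_above bounded_imp_bdd_below)
  have "convex hull S \<subseteq> {x. c \<bullet> x \<le> (SUP x\<in>S. c \<bullet> x)}"
    by (intro hull_minimal convex_halfspace_le) (auto intro: cSUP_upper bdd)
  moreover have "convex hull S \<subseteq> {x. (INF x\<in>S. c \<bullet> x) \<le> c \<bullet> x}"
    by (intro hull_minimal convex_halfspace_ge) (auto intro: cINF_lower bdd)
  ultimately show ?thesis
    using assms(2,3) by (intro diff_mono) auto
qed

text \<open>Source of the factor \<open>p\<close> in the tightening: at most that many agents
  deviate from the primal solution.\<close>

lemma sum_le_card_support_bound:
  fixes \<phi> :: "'m::finite \<Rightarrow> real"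
  assumes "\<And>i. \<phi> i \<le> M" "\<And>i. i \<notin> I \<Longrightarrow> \<phi> i = 0" "card I \<le> n" "0 \<le> M"
  shows "(\<Sum>i\<in>UNIV. \<phi> i) \<le> real n * M"
proof -
  have "(\<Sum>i\<in>UNIV. \<phi> i) = (\<Sum>i\<in>I. \<phi> i)"
    using assms(2) by (intro sum.mono_neutral_right) auto
  also have "\<dots> \<le> real (card I) * M"
    using assms(1) by (intro sum_bounded_above) auto
  also have "\<dots> \<le> real n * M"
    using assms(3,4) by (intro mult_right_mono) auto
  finally show ?thesis .
qed

text \<open>Finitely many indices already produce every value, and a long enough initial segment
  contains them.\<close>

lemma eventually_image_atLeastAtMost:
  fixes f :: "nat \<Rightarrow> 'a"
  assumes "finite (f ` {1..})"
  shows "eventually (\<lambda>k. f ` {1..k} = f ` {1..}) sequentially"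
proof -
  obtain T where T: "T \<subseteq> {1..}" "finite T" "f ` {1..} = f ` T"
    using finite_subset_image[OF assms order_refl] by blast
  obtain K where K: "T \<subseteq> {..K}"
    using T(2) finite_nat_iff_bounded_le by blast
  have "f ` {1..k} = f ` {1..}" if "k \<ge> K" for k
  proof
    have "T \<subseteq> {1..k}"
      using K T(1) that by fastforce
    then show "f ` {1..} \<subseteq> f ` {1..k}"
      unfolding T(3) by (rule image_mono)
  qed auto
  then show ?thesis
    unfolding eventually_sequentially by blast
qed

text \<open>The first iterate absorbs the initial infinite value; hence the statement starts at
  \<open>Suc k\<close>.\<close>

lemma s_upper_eq_Max:
  "s_upper A x (Suc k) i $ j = ereal (Max ((\<lambda>r. (A i *v x r i) $ j) ` {1..Suc k}))"
proof (induction k)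
  case 0
  then show ?case
    by simp
next
  case (Suc k)
  have "{1..Suc (Suc k)} = insert (Suc (Suc k)) {1..Suc k}"
    by auto
  moreover have "Max (insert a M) = max (Max M) a" if "finite M" "M \<noteq> {}" for M and a :: real
    using that by (simp add: max.commute)
  ultimately have "Max ((\<lambda>r. (A i *v x r i) $ j) ` {1..Suc (Suc k)}) =
      max (Max ((\<lambda>r. (A i *v x r i) $ j) ` {1..Suc k})) ((A i *v x (Suc (Suc k)) i) $ j)"
    by (simp del: Max_insert)
  moreover have "ereal (max u v) = max (ereal u) (ereal v)" for u v
    by (simp add: max_def)
  ultimately show ?case
    using Suc by simp
qed

lemma s_lower_eq_Min:
  "s_lower A x (Suc k) i $ j = ereal (Min ((\<lambda>r. (A i *v x r i) $ j) ` {1..Suc k}))"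
proof (induction k)
  case 0
  then show ?case
    by simp
next
  case (Suc k)
  have "{1..Suc (Suc k)} = insert (Suc (Suc k)) {1..Suc k}"
    by auto
  moreover have "Min (insert a M) = min (Min M) a" if "finite M" "M \<noteq> {}" for M and a :: real
    using that by (simp add: min.commute)
  ultimately have "Min ((\<lambda>r. (A i *v x r i) $ j) ` {1..Suc (Suc k)}) =
      min (Min ((\<lambda>r. (A i *v x r i) $ j) ` {1..Suc k})) ((A i *v x (Suc (Suc k)) i) $ j)"
    by (simp del: Min_insert)
  moreover have "ereal (min u v) = min (ereal u) (ereal v)" for u v
    by (simp add: min_def)
  ultimately show ?case
    using Suc by simp
qed

text \<open>Passing from running extremes to a spread over visited points makes the hull bound
  applicable.\<close>

lemma rho_agent_eq_spread:
  assumes "k \<ge> 1"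
  shows "rho_agent A x k i $ j = spread (\<lambda>v. (A i *v v) $ j) ((\<lambda>r. x r i) ` {1..k})"
  using assms s_upper_eq_Max[of A x "k - 1" i j] s_lower_eq_Min[of A x "k - 1" i j]
  unfolding rho_agent_def spread_def by (simp add: image_image)

lemma linear_matrix_vector_nth: "linear (\<lambda>v. ((B :: real ^ 'n ^ 'p) *v v) $ j)"
  by (rule linearI) (simp_all add: matrix_vector_right_distrib matrix_vector_mult_scaleR)

section \<open>Finite-time feasibility and suboptimality\<close>

theorem theorem4:
  fixes C Z :: "'m::finite \<Rightarrow> 'n::finite set"
    and q :: "'m \<Rightarrow> nat"
    and D :: "'m \<Rightarrow> nat \<Rightarrow> real ^ 'n"
    and d :: "'m \<Rightarrow> nat \<Rightarrow> real"
    and X :: "'m \<Rightarrow> (real ^ 'n) set"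
    and c :: "'m \<Rightarrow> real ^ 'n"
    and A :: "'m \<Rightarrow> real ^ 'n ^ 'p::finite"
    and b rhobar :: "real ^ 'p"
    and \<alpha> :: "nat \<Rightarrow> real"
    and tie :: "'m \<Rightarrow> real ^ 'p \<Rightarrow> real ^ 'n"
    and x :: "nat \<Rightarrow> 'm \<Rightarrow> real ^ 'n"
    and lam :: "nat \<Rightarrow> real ^ 'p"
    and \<zeta> gammabar :: real
  assumes disjoint: "\<And>i. C i \<inter> Z i = {}"
    and X: "\<And>i. X i = mixed_integer_set (C i) (Z i) (q i) (D i) (d i)"
    and nonempty: "\<And>i. X i \<noteq> {}"
    and step_pos: "\<And>k. \<alpha> k > 0"
    and step_lim: "\<alpha> \<longlonglongrightarrow> 0"
    and step_sum: "filterlim (\<lambda>N. \<Sum>k<N. \<alpha> k) at_top sequentially"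
    and run: "algorithm_run c A b X \<alpha> tie x lam"
    and rhobar: "rhobar = lim (rho_seq A x)"
    and gammabar: "gammabar = lim (gamma_seq CARD('p) c x)"
    and boundedness: "\<And>i. bounded (X i)"
    and unique_primal: "\<exists>!y. lp_solution c A (b - rhobar) X y"
    and unique_dual: "\<exists>!l. dual_solution c A (b - rhobar) X l"
    and zeta_pos: "\<zeta> > 0"
    and slater: "\<exists>xh. (\<forall>i. xh i \<in> convex hull X i) \<and>
                   (\<Sum>i\<in>UNIV. A i *v xh i) \<le> b - rhobar - (real CARD('m) * \<zeta>) *\<^sub>R 1"
  shows "\<exists>K\<ge>1. \<forall>k\<ge>K. coupled_feasible A b X (x k) \<and>
           total_cost c (x k) - optimal_cost c A b X
             \<le> gammabar + infnorm rhobar / (real CARD('p) * \<zeta>) * gamma_tilde CARD('p) c X"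
proof -
  \<comment> \<open>Index 0 is left out because \<open>x 0\<close> is not an iterate.\<close>
  define V where "V i = (\<lambda>r. x r i) ` {1..}" for i
  define R where "R i j = spread (\<lambda>v. (A i *v v) $ j) (V i)" for i j
  define Q where "Q i = spread (\<lambda>v. c i \<bullet> v) (V i)" for i
  interpret coupled_lp c A "b - rhobar" X
  proof
    fix i
    show "compact (X i)"
      using boundedness[of i] closed_mixed_integer_set unfolding X by (simp add: compact_eq_bounded_closed)
    show "X i \<noteq> {}"
      by (rule nonempty)
    show "finite {v. v extreme_point_of (convex hull X i)}"
      using boundedness[of i] unfolding X by (rule finite_extreme_points_mixed_integer)
  qed
  have run_step: "x (Suc k) i \<in> face (lam k) i" "x (Suc k) i \<in> vertices i" for k i
    using run is_arg_min_vertex_face unfolding algorithm_run_def by blast+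
  have lam_Suc: "lam (Suc k) = (\<chi> j. max 0 ((lam k +
      \<alpha> k *\<^sub>R ((\<Sum>i\<in>UNIV. A i *v x (Suc k) i) - b + rho_seq A x (Suc k))) $ j))" for k
    using run unfolding algorithm_run_def closest_point_nonneg_orthant by blast
  have lam_nonneg: "0 \<le> lam k" for k
  proof (cases k)
    case 0
    then show ?thesis
      using run unfolding algorithm_run_def by simp
  next
    case (Suc n)
    then show ?thesis
      using lam_Suc[of n] by (simp add: less_eq_vec_def)
  qed
  have V_ne: "V i \<noteq> {}" for i
    unfolding V_def by auto
  have "V i \<subseteq> vertices i" for i
  proof
    fix v assume "v \<in> V i"
    then obtain r where "v = x (Suc r) i"
      unfolding V_def by (metis One_nat_def atLeast_iff imageE le_Suc_ex plus_1_eq_Suc)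
    then show "v \<in> vertices i"
      using run_step by blast
  qed
  then have V_fin: "finite (V i)" for i
    using finite_vertices finite_subset unfolding vertices_def by blast

  \<comment> \<open>Limits of the tightening and of the cost spread\<close>
  have "eventually (\<lambda>k. \<forall>i. (\<lambda>r. x r i) ` {1..k} = V i) sequentially"
    using V_fin unfolding V_def by (intro eventually_all_finite eventually_image_atLeastAtMost)
  then have visited: "eventually (\<lambda>k. k \<ge> 1 \<and> (\<forall>i. (\<lambda>r. x r i) ` {1..k} = V i)) sequentially"
    using eventually_ge_at_top[of 1] by eventually_elim blast
  \<comment> \<open>Once all points of \<open>V\<close> have been visited the spreads are final, so
    \<open>lim\<close> denotes an attained value.\<close>
  have rho_lim: "eventually (\<lambda>k. rho_seq A x k = (\<chi> j. real CARD('p) * (MAX i. R i j))) sequentially"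
    using visited
    by eventually_elim (simp add: rho_seq_def R_def rho_agent_eq_spread)
  then have rho_eq: "rhobar = (\<chi> j. real CARD('p) * (MAX i. R i j))"
    unfolding rhobar by (intro limI tendsto_eventually)
  have "eventually (\<lambda>k. gamma_seq CARD('p) c x k = real CARD('p) * (MAX i. Q i)) sequentially"
    using visited
  proof eventually_elim
    case (elim k)
    have "(\<lambda>r. c i \<bullet> x r i) ` {1..k} = (\<lambda>v. c i \<bullet> v) ` V i" for i
      using elim by (simp add: image_image flip: elim[THEN conjunct2, rule_format])
    then show ?case
      unfolding gamma_seq_def Q_def spread_def by simp
  qed
  then have gamma_eq: "gammabar = real CARD('p) * (MAX i. Q i)"
    unfolding gammabar by (intro limI tendsto_eventually)

  \<comment> \<open>Convergence of the multipliers and location of the primal solution\<close>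
  obtain ls where ls: "dual_solution c A (b - rhobar) X ls"
    "\<And>l. dual_solution c A (b - rhobar) X l \<Longrightarrow> l = ls"
    using unique_dual by blast
  obtain xs where xs: "\<And>z. lp_solution c A (b - rhobar) X z \<Longrightarrow> z = xs"
    using unique_primal by blast
  have ls_nonneg: "0 \<le> ls"
    using ls(1) unfolding dual_solution_def is_arg_max_def by simp
  note xs_face = unique_solutions_face(1)[OF ls xs]
  have xs_cost: "total_cost c xs = dual ls"
    by (rule unique_solutions_face(2)[OF ls xs])
  \<comment> \<open>Update \<open>k\<close> uses the tightening at \<open>Suc k\<close>, hence the
    shift. Once it equals \<open>rhobar\<close>, this is a subgradient step for
    \<open>b - rhobar\<close>.\<close>
  have step: "eventually (\<lambda>k. lam (Suc k) =
      (\<chi> j. max 0 ((lam k + \<alpha> k *\<^sub>R (load A (x (Suc k)) - (b - rhobar))) $ j))) sequentially"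
    using rho_lim[unfolded eventually_sequentially_Suc[symmetric, of "\<lambda>k. rho_seq A x k = _"]]
    unfolding rho_eq[symmetric]
  proof eventually_elim
    case (elim k)
    then show ?case
      using lam_Suc[of k] by (simp add: load_def algebra_simps)
  qed
  have lam_lim: "lam \<longlonglongrightarrow> ls"
    by (rule multipliers_converge[where w = "\<lambda>k. x (Suc k)",
          OF ls step_pos step_lim step_sum lam_nonneg run_step step])
  obtain N where N: "\<And>k i. k \<ge> N \<Longrightarrow> x (Suc k) i \<in> face ls i"
    using eventually_face_subset[OF lam_lim] run_step unfolding eventually_sequentially by blast
  \<comment> \<open>\<open>y\<close> averages iterates after \<open>N\<close>, which all lie in the
    optimal faces; its complementary load then makes it optimal, so it is \<open>xs\<close>.\<close>
  obtain y where y: "\<And>i. y i \<in> convex hull {x (Suc k) i | k. k \<ge> N}"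
    "load A y - (b - rhobar) \<in> slack_cone ls"
    using visited_hull_slack[where w = "\<lambda>k. x (Suc k)" and K = N,
        OF ls_nonneg lam_lim step_pos step_sum run_step(2) step] by blast
  have "convex hull {x (Suc k) i | k. k \<ge> N} \<subseteq> face ls i" for i
    using N by (intro hull_minimal convex_face) auto
  then have "y i \<in> face ls i" for i
    using y(1) by blast
  then have y_eq: "y = xs"
    using face_slack_optimal(1)[OF ls_nonneg _ y(2)] xs by blast
  \<comment> \<open>Placing \<open>xs i\<close> in the hull of visited points is what allows
    observed spreads to bound deviations from it.\<close>
  have "{x (Suc k) i | k. k \<ge> N} \<subseteq> V i" for i
    unfolding V_def by auto
  then have xs_hull: "xs i \<in> convex hull V i" for i
    using y(1) hull_mono unfolding y_eq by blast

  \<comment> \<open>Feasibility and cost relative to the tightened optimum\<close>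
  define I where "I = {i. face ls i \<noteq> {xs i}}"
  have I: "card I \<le> CARD('p)"
    unfolding I_def by (rule card_nontrivial_faces[OF ls xs])
  have feasible: "coupled_feasible A b X (x k)"
    and cost: "total_cost c (x k) \<le> total_cost c xs + gammabar" if k: "k > N" for k
  proof -
    have x_V: "x k i \<in> V i" for i
      using k unfolding V_def by auto
    obtain n where n: "k = Suc n" "n \<ge> N"
      using k by (metis Suc_le_D Suc_le_mono Suc_leI)
    then have x_xs: "x k i = xs i" if "i \<notin> I" for i
      using N[of n i] that unfolding I_def by auto
    \<comment> \<open>Stated for arbitrary linear functions because it serves both the cost and each
      load coordinate.\<close>
    have bound: "(\<Sum>i\<in>UNIV. f i (x k i) - f i (xs i)) \<le> real CARD('p) * (MAX i. spread (f i) (V i))"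
      if "\<And>i. linear (f i)" for f :: "'m \<Rightarrow> real ^ 'n \<Rightarrow> real"
    proof (rule sum_le_card_support_bound[where I = I])
      show "f i (x k i) - f i (xs i) \<le> (MAX i. spread (f i) (V i))" for i
        using diff_le_spread_hull[OF that V_fin x_V xs_hull]
        by (rule order.trans) (intro Max_ge, auto)
      have "0 \<le> spread (f i) (V i)" for i
        by (rule spread_nonneg[OF V_fin V_ne])
      then show "0 \<le> (MAX i. spread (f i) (V i))"
        by (auto simp: Max_ge_iff)
    qed (use x_xs I in auto)
    show "total_cost c (x k) \<le> total_cost c xs + gammabar"
      using bound[of "\<lambda>i v. c i \<bullet> v"]
      unfolding gamma_eq Q_def total_cost_def
      by (simp add: sum_subtractf bounded_linear.linear bounded_linear_inner_right)
    \<comment> \<open>\<open>xs\<close> leaves a margin \<open>rhobar $ j\<close>, which is exactly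
      the bound on the total deviation.\<close>
    have "(\<Sum>i\<in>UNIV. A i *v x k i) $ j \<le> b $ j" for j
    proof -
      have "load A xs $ j \<le> b $ j - rhobar $ j"
        using y(2) unfolding y_eq slack_cone_def by (simp add: less_eq_vec_def)
      moreover have "(\<Sum>i\<in>UNIV. (A i *v x k i) $ j - (A i *v xs i) $ j) \<le> rhobar $ j"
        using bound[of "\<lambda>i v. (A i *v v) $ j", OF linear_matrix_vector_nth]
        unfolding rho_eq R_def by simp
      ultimately show ?thesis
        unfolding load_def by (simp add: sum_subtractf)
    qed
    moreover have "x k i \<in> X i" for i
      using run_step(2) vertices_subset unfolding n(1) by blast
    ultimately show "coupled_feasible A b X (x k)"
      unfolding coupled_feasible_def by (simp add: less_eq_vec_def)
  qed

  \<comment> \<open>Price of the tightening\<close>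
  define S where "S = (\<Sum>j\<in>UNIV. ls $ j)"
  \<comment> \<open>Weak duality against the original problem: a feasible point exceeds the
    tightened bound by at most \<open>rhobar\<close>, which the multiplier prices at no more than
    \<open>infnorm rhobar * S\<close>.\<close>
  have weak: "total_cost c xs - infnorm rhobar * S \<le> optimal_cost c A b X"
    unfolding optimal_cost_def
  proof (rule cINF_greatest)
    show "{z. coupled_feasible A b X z} \<noteq> {}"
      using feasible[of "Suc N"] by blast
    fix z assume "z \<in> {z. coupled_feasible A b X z}"
    then have z: "load A z \<le> b" "\<And>i. z i \<in> convex hull X i"
      using hull_inc[of _ "X _" convex] unfolding coupled_feasible_def load_def by auto
    have "ls \<bullet> (load A z - (b - rhobar)) \<le> infnorm rhobar * S"
      unfolding inner_vec_def S_def sum_distrib_left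
    proof (rule sum_mono)
      fix j
      have "(load A z - (b - rhobar)) $ j \<le> infnorm rhobar"
        using z(1) component_le_infnorm_cart[of rhobar j] by (simp add: less_eq_vec_def) (smt (verit))
      then have "ls $ j * (load A z - (b - rhobar)) $ j \<le> ls $ j * infnorm rhobar"
        using ls_nonneg by (intro mult_left_mono) (auto simp: less_eq_vec_def)
      then show "ls $ j \<bullet> (load A z - (b - rhobar)) $ j \<le> infnorm rhobar * ls $ j"
        by (simp add: mult.commute)
    qed
    then show "total_cost c xs - infnorm rhobar * S \<le> total_cost c z"
      using dual_le_lagrangian[OF z(2), of ls] xs_cost unfolding lagrangian_def by linarith
  qed
  obtain xh where xh: "\<And>i. xh i \<in> convex hull X i"
    "load A xh \<le> b - rhobar - (real CARD('m) * \<zeta>) *\<^sub>R 1"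
    using slater unfolding load_def by blast
  define G where "G = (MAX i. (SUP x\<in>X i. c i \<bullet> x) - (INF x\<in>X i. c i \<bullet> x))"
  \<comment> \<open>At the Slater point every tightened constraint has slack at least
    \<open>real CARD('m) * \<zeta>\<close>, so weak duality bounds the sum of the multipliers by a
    cost difference of at most \<open>G\<close> per agent.\<close>
  have "real CARD('m) * \<zeta> * S \<le> real CARD('m) * G"
  proof -
    have "ls \<bullet> (load A xh - (b - rhobar)) \<le> (\<Sum>j\<in>UNIV. ls $ j * - (real CARD('m) * \<zeta>))"
      unfolding inner_vec_def
    proof (rule sum_mono)
      fix j
      have "(load A xh - (b - rhobar)) $ j \<le> - (real CARD('m) * \<zeta>)"
        using xh(2) by (simp add: less_eq_vec_def) (smt (verit))
      then show "ls $ j \<bullet> (load A xh - (b - rhobar)) $ j \<le> ls $ j * - (real CARD('m) * \<zeta>)"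
        using ls_nonneg unfolding inner_real_def by (intro mult_left_mono) (auto simp: less_eq_vec_def)
    qed
    also have "\<dots> = - (real CARD('m) * \<zeta> * S)"
      unfolding S_def by (simp add: sum_distrib_right sum_negf mult.commute flip: sum_distrib_left)
    finally have "real CARD('m) * \<zeta> * S \<le> total_cost c xh - total_cost c xs"
      using dual_le_lagrangian[OF xh(1), of ls] xs_cost unfolding lagrangian_def by linarith
    also have "\<dots> = (\<Sum>i\<in>UNIV. c i \<bullet> xh i - c i \<bullet> xs i)"
      unfolding total_cost_def by (simp add: sum_subtractf)
    also have "\<dots> \<le> (\<Sum>i\<in>(UNIV :: 'm set). G)"
    proof (rule sum_mono)
      fix i
      have "c i \<bullet> xh i - c i \<bullet> xs i \<le> (SUP x\<in>X i. c i \<bullet> x) - (INF x\<in>X i. c i \<bullet> x)"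
        using xs_face face_subset_hull by (intro inner_diff_le_hull_spread boundedness xh(1)) blast
      also have "\<dots> \<le> G"
        unfolding G_def by (intro Max_ge) auto
      finally show "c i \<bullet> xh i - c i \<bullet> xs i \<le> G" .
    qed
    finally show ?thesis
      by simp
  qed
  then have "S \<le> G / \<zeta>"
    using zeta_pos by (simp add: field_simps)
  then have "infnorm rhobar * S \<le> infnorm rhobar * (G / \<zeta>)"
    by (intro mult_left_mono infnorm_pos_le)
  \<comment> \<open>The factor \<open>p\<close> inside \<open>gamma_tilde\<close> cancels the one in
    the denominator.\<close>
  also have "\<dots> = infnorm rhobar / (real CARD('p) * \<zeta>) * gamma_tilde CARD('p) c X"
    unfolding gamma_tilde_def G_def by simp
  finally have "total_cost c xs - optimal_cost c A b X
      \<le> infnorm rhobar / (real CARD('p) * \<zeta>) * gamma_tilde CARD('p) c X"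
    using weak by simp
  \<comment> \<open>The gap splits at the cost of \<open>xs\<close>. Both bounds on the iterates
    hold for \<open>k > N\<close>, hence \<open>Suc N\<close>, which is also at least 1.\<close>
  then show ?thesis
    using feasible cost by (intro exI[of _ "Suc N"]) (force simp: Suc_le_eq)
qed

end
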